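(* Let $T$ be a tree on $n$ vertices with maximum degree $\Delta=\Delta(T)$, let $d\ge2$, $\chi\in\mathbb N$, $\epsilon\in(0,1]$, $\delta\in(0,1)$, and let $\rho$ be an arbitrary $n$-qudit state satisfying $$\mathrm{OPT}_{T,\chi}(\rho):=\sup_{|\phi\rangle\in\mathcal S_d(T,\chi)}\langle\phi|\rho|\phi\rangle\ge\vartheta$$ for a known $\vartheta\in(0,1]$. Then one can output a pure state $|\hat\psi\rangle$ satisfying $$\langle\hat\psi|\rho|\hat\psi\rangle\ge\mathrm{OPT}_{T,\chi}(\rho)-\epsilon$$ with probability at least $1-\delta$, using $$O\left(\frac{n^5\chi^2}{\vartheta\,\min\{\epsilon,\vartheta\}^4}\left(d^{2(1+bp_T)}+\log(n/\delta)\right)\right)$$ copies of $\rho$, where $b$ is the maximum number of children after rooting $T$ at a leaf and $$p_T=\max\left\{1,\left\lceil\log_d\left(\frac{2048\,n^2\chi}{\min\{\epsilon,\vartheta\}^2}\right)\right\rceil\right\}.$$ For $n\ge3$, one may take $b\le\Delta-1$.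
   Context: $\mathcal S_d(T,\chi)$: pure (unit) states in $(\mathbb C^d)^{\otimes n}$ (one qudit per vertex of $T$) whose amplitudes can be written $\psi_{i_1,\dots,i_n}=\sum_{(j_e)\in\prod_{e\in E(T)}[w(e)]}\prod_{v}\varphi^{[v]}_{i_v}((j_e)_{e\ni v})$ for some weights $w:E(T)\to\{1,\dots,\chi\}$ and complex tensors $\varphi^{[v]}$ with one physical index $i_v\in[d]$ and one virtual index $j_e\in[w(e)]$ per incident edge. "Rooting $T$ at a leaf" means rooting at a vertex of degree one if $n\ge2$ and at the only vertex if $n=1$. Learning model: the algorithm knows $T,d,\chi,\epsilon,\delta,\vartheta$, receives i.i.d. copies of $\rho$, may perform arbitrary (collective, adaptive) quantum measurements, and outputs a classical description of a pure state (not required to lie in $\mathcal S_d(T,\chi)$). $O(\cdot)$ hides absolute constants. Known fact available as a primitive: arbitrary states on a $D$-dimensional space can be learned to trace norm error $\alpha$ with failure probability $\beta$ from $O((D^2+\log(1/\beta))/\alpha^2)$ copies. *)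

theory Defs
  imports Complex_Main "HOL-Library.FuncSet" "HOL-Library.Nonpos_Ints"
begin

section \<open>Trees\<close>

text \<open>Simple graphs are given by a vertex set \<open>V\<close> and a set \<open>E\<close> of two-element edges.
  Vertices are natural numbers, so that one absolute constant can serve all trees; every finite
  tree is isomorphic to one of this kind.\<close>

definition simple_graph :: "nat set \<Rightarrow> nat set set \<Rightarrow> bool" where
  "simple_graph V E \<longleftrightarrow> finite V \<and> (\<forall>e\<in>E. e \<subseteq> V \<and> card e = 2)"

definition incident :: "nat set set \<Rightarrow> nat \<Rightarrow> nat set set" where
  "incident E v = {e \<in> E. v \<in> e}"

definition degree :: "nat set set \<Rightarrow> nat \<Rightarrow> nat" where
  "degree E v = card (incident E v)"

definition max_degree :: "nat set \<Rightarrow> nat set set \<Rightarrow> nat" where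
  "max_degree V E = Max (degree E ` V)"

definition is_path :: "nat set set \<Rightarrow> nat list \<Rightarrow> bool" where
  "is_path E p \<longleftrightarrow> p \<noteq> [] \<and> distinct p \<and> successively (\<lambda>u v. {u, v} \<in> E) p"

definition is_cycle :: "nat set set \<Rightarrow> nat list \<Rightarrow> bool" where
  "is_cycle E c \<longleftrightarrow> is_path E c \<and> 3 \<le> length c \<and> {last c, hd c} \<in> E"

definition is_tree :: "nat set \<Rightarrow> nat set set \<Rightarrow> bool" where
  "is_tree V E \<longleftrightarrow> simple_graph V E \<and> V \<noteq> {} \<and>
     (\<forall>u\<in>V. \<forall>v\<in>V. \<exists>p. is_path E p \<and> hd p = u \<and> last p = v) \<and>
     (\<nexists>c. is_cycle E c)"

definition leaf_root :: "nat set \<Rightarrow> nat set set \<Rightarrow> nat \<Rightarrow> bool" where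
  "leaf_root V E r \<longleftrightarrow> r \<in> V \<and> (2 \<le> card V \<longrightarrow> degree E r = 1)"

text \<open>The children of \<open>v\<close> in the tree rooted at \<open>r\<close>: the vertices whose path from the root has
  \<open>v\<close> as its penultimate vertex.\<close>

definition children :: "nat set set \<Rightarrow> nat \<Rightarrow> nat \<Rightarrow> nat set" where
  "children E r v = {u. \<exists>q. is_path E (q @ [v, u]) \<and> hd (q @ [v, u]) = r}"

definition max_children :: "nat set \<Rightarrow> nat set set \<Rightarrow> nat \<Rightarrow> nat" where
  "max_children V E r = Max ((\<lambda>v. card (children E r v)) ` V)"


section \<open>States and measurements\<close>

text \<open>A finite-dimensional Hilbert space is represented by the finite set \<open>I\<close> labelling an
  orthonormal basis; vectors and operators are the functions \<open>'i \<Rightarrow> complex\<close> and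
  \<open>'i \<Rightarrow> 'i \<Rightarrow> complex\<close> of their coordinates, of which only the values on \<open>I\<close> matter.\<close>

definition quad_form :: "'i set \<Rightarrow> ('i \<Rightarrow> 'i \<Rightarrow> complex) \<Rightarrow> ('i \<Rightarrow> complex) \<Rightarrow> complex" where
  "quad_form I A x = (\<Sum>i\<in>I. \<Sum>j\<in>I. cnj (x i) * A i j * x j)"

definition psd :: "'i set \<Rightarrow> ('i \<Rightarrow> 'i \<Rightarrow> complex) \<Rightarrow> bool" where
  "psd I A \<longleftrightarrow> (\<forall>x. quad_form I A x \<in> \<real>\<^sub>\<ge>\<^sub>0)"

definition trace_on :: "'i set \<Rightarrow> ('i \<Rightarrow> 'i \<Rightarrow> complex) \<Rightarrow> complex" where
  "trace_on I A = (\<Sum>i\<in>I. A i i)"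

definition op_mult ::
  "'i set \<Rightarrow> ('i \<Rightarrow> 'i \<Rightarrow> complex) \<Rightarrow> ('i \<Rightarrow> 'i \<Rightarrow> complex) \<Rightarrow> 'i \<Rightarrow> 'i \<Rightarrow> complex" where
  "op_mult I A B = (\<lambda>i j. \<Sum>k\<in>I. A i k * B k j)"

definition density_op :: "'i set \<Rightarrow> ('i \<Rightarrow> 'i \<Rightarrow> complex) \<Rightarrow> bool" where
  "density_op I \<rho> \<longleftrightarrow> psd I \<rho> \<and> trace_on I \<rho> = 1"

definition pure_state :: "'i set \<Rightarrow> ('i \<Rightarrow> complex) \<Rightarrow> bool" where
  "pure_state I \<psi> \<longleftrightarrow> (\<Sum>i\<in>I. (cmod (\<psi> i))\<^sup>2) = 1"

text \<open>\<open>\<langle>\<psi>|\<rho>|\<psi>\<rangle>\<close>, which is real for positive semidefinite \<open>\<rho>\<close>.\<close>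

definition fidelity :: "'i set \<Rightarrow> ('i \<Rightarrow> 'i \<Rightarrow> complex) \<Rightarrow> ('i \<Rightarrow> complex) \<Rightarrow> real" where
  "fidelity I \<rho> \<psi> = Re (quad_form I \<rho> \<psi>)"

definition copies_basis :: "nat \<Rightarrow> 'i set \<Rightarrow> (nat \<Rightarrow> 'i) set" where
  "copies_basis N I = {..<N} \<rightarrow>\<^sub>E I"

definition tensor_power ::
  "nat \<Rightarrow> ('i \<Rightarrow> 'i \<Rightarrow> complex) \<Rightarrow> (nat \<Rightarrow> 'i) \<Rightarrow> (nat \<Rightarrow> 'i) \<Rightarrow> complex" where
  "tensor_power N \<rho> = (\<lambda>x y. \<Prod>k<N. \<rho> (x k) (y k))"

definition povm :: "'i set \<Rightarrow> 'a set \<Rightarrow> ('a \<Rightarrow> 'i \<Rightarrow> 'i \<Rightarrow> complex) \<Rightarrow> bool" where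
  "povm I \<Omega> M \<longleftrightarrow> finite \<Omega> \<and> (\<forall>a\<in>\<Omega>. psd I (M a)) \<and>
     (\<forall>x\<in>I. \<forall>y\<in>I. (\<Sum>a\<in>\<Omega>. M a x y) = (if x = y then 1 else 0))"

definition outcome_prob ::
  "'i set \<Rightarrow> ('a \<Rightarrow> 'i \<Rightarrow> 'i \<Rightarrow> complex) \<Rightarrow> ('i \<Rightarrow> 'i \<Rightarrow> complex) \<Rightarrow> 'a set \<Rightarrow> real" where
  "outcome_prob I M \<rho> S = (\<Sum>a\<in>S. Re (trace_on I (op_mult I (M a) \<rho>)))"

text \<open>A learning procedure that uses \<open>N\<close> copies of a state on the space with basis \<open>I\<close> and
  outputs a pure state. Any protocol on \<open>N\<close> copies, however adaptive and including its
  randomness and classical post-processing, is a single POVM on the \<open>N\<close>-fold tensor power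
  followed by a map \<open>out\<close> from outcome labels to outputs. Finitely many labels reflect that the
  output is a classical description.\<close>

definition learner ::
  "'i set \<Rightarrow> nat \<Rightarrow> nat set \<Rightarrow> (nat \<Rightarrow> (nat \<Rightarrow> 'i) \<Rightarrow> (nat \<Rightarrow> 'i) \<Rightarrow> complex)
     \<Rightarrow> (nat \<Rightarrow> 'i \<Rightarrow> complex) \<Rightarrow> bool" where
  "learner I N \<Omega> M out \<longleftrightarrow> povm (copies_basis N I) \<Omega> M \<and> (\<forall>a\<in>\<Omega>. pure_state I (out a))"

definition success_prob ::
  "'i set \<Rightarrow> nat \<Rightarrow> nat set \<Rightarrow> (nat \<Rightarrow> (nat \<Rightarrow> 'i) \<Rightarrow> (nat \<Rightarrow> 'i) \<Rightarrow> complex)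
     \<Rightarrow> (nat \<Rightarrow> 'i \<Rightarrow> complex) \<Rightarrow> ('i \<Rightarrow> 'i \<Rightarrow> complex) \<Rightarrow> (('i \<Rightarrow> complex) \<Rightarrow> bool) \<Rightarrow> real" where
  "success_prob I N \<Omega> M out \<rho> good =
     outcome_prob (copies_basis N I) M (tensor_power N \<rho>) {a\<in>\<Omega>. good (out a)}"


section \<open>Tree tensor network states\<close>

definition qudit_basis :: "nat set \<Rightarrow> nat \<Rightarrow> (nat \<Rightarrow> nat) set" where
  "qudit_basis V d = V \<rightarrow>\<^sub>E {..<d}"

text \<open>Index ranges \<open>[d]\<close> and \<open>[w(e)]\<close> start at \<open>0\<close>. The tensor at \<open>v\<close> takes the physical index
  \<open>i v\<close> and the virtual indices \<open>j\<close> restricted to the edges incident to \<open>v\<close>.\<close>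

definition ttn_states :: "nat set \<Rightarrow> nat set set \<Rightarrow> nat \<Rightarrow> nat \<Rightarrow> ((nat \<Rightarrow> nat) \<Rightarrow> complex) set" where
  "ttn_states V E d \<chi> = {\<psi>. pure_state (qudit_basis V d) \<psi> \<and>
     (\<exists>(w :: nat set \<Rightarrow> nat) (\<phi> :: nat \<Rightarrow> nat \<Rightarrow> (nat set \<Rightarrow> nat) \<Rightarrow> complex).
        (\<forall>e\<in>E. w e \<in> {1..\<chi>}) \<and>
        (\<forall>i\<in>qudit_basis V d.
           \<psi> i = (\<Sum>j \<in> (\<Pi>\<^sub>E e\<in>E. {..<w e}). \<Prod>v\<in>V. \<phi> v (i v) (restrict j (incident E v)))))}"

definition OPT ::
  "nat set \<Rightarrow> nat set set \<Rightarrow> nat \<Rightarrow> nat \<Rightarrow> ((nat \<Rightarrow> nat) \<Rightarrow> (nat \<Rightarrow> nat) \<Rightarrow> complex) \<Rightarrow> real" where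
  "OPT V E d \<chi> \<rho> = (SUP \<phi>\<in>ttn_states V E d \<chi>. fidelity (qudit_basis V d) \<rho> \<phi>)"

definition p_T :: "nat \<Rightarrow> nat \<Rightarrow> nat \<Rightarrow> real \<Rightarrow> real \<Rightarrow> nat" where
  "p_T n d \<chi> \<epsilon> \<theta> =
     nat (max 1 \<lceil>log (real d) (2048 * (real n)\<^sup>2 * real \<chi> / (min \<epsilon> \<theta>)\<^sup>2)\<rceil>)"

end

theory Submission
  imports Defs "HOL-Library.Nat_Bijection"
begin

text \<open>Measure every copy by one fixed POVM that does not depend on the tree: a rank-one frame whose
  vectors have independent coordinates, uniform on \<open>{\<surd>2, \<i>\<surd>2, -\<surd>2, -\<i>\<surd>2, 0, 0, 0, 0}\<close>. These
  agree with complex Gaussians up to fourth moments and are dominated by them in the sixth, so the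
  squared overlap of an outcome with a pure state \<open>h\<close>, minus one, is an unbiased estimator of
  \<open>\<langle>h|\<rho>|h\<rangle>\<close> with second moment bounded independently of the dimension. After clipping, a Chernoff
  bound and a union bound show that \<open>O(log (|H| / \<delta>) / \<epsilon>\<^sup>2)\<close> copies suffice to select a nearly
  optimal state from a finite set \<open>H\<close>.

  Tree tensor network states have a small net \<open>H\<close>. Only the amplitudes of a state are bounded, not
  its tensors, so leaves are eliminated one at a time by a bounded interpolation in the leaf index,
  which turns a state on the tree into amplitudes on the smaller tree together with bounded
  coefficients, and both are discretised. The logarithm of the size of \<open>H\<close> is polynomial in \<open>n\<close>,
  \<open>\<chi>\<close>, \<open>1 / \<epsilon>\<close> times \<open>d\<^sup>2 \<chi>\<^bsup>2b\<^esup>\<close>, and \<open>\<chi> \<le> d\<^bsup>p\<^esup>\<close>.\<close>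

section \<open>Positive semidefinite operators\<close>

text \<open>A finite alphabet gives a POVM with finitely many outcomes and turns Gaussian integrals
  into finite averages, computed by adding one coordinate at a time. A raw overlap can reach
  \<open>2 * d ^ n\<close>, so concentration has to rest on its second moment and not on its range;
  under the outcome distribution this is a sixth moment of the letters, which is why moments of that
  order are controlled. For the net, precision is cheap: passing from entrywise errors to fidelities
  loses a factor of order \<open>d ^ (2 * n)\<close> and each eliminated leaf a factor
  \<open>2 ^ (\<chi> + 2)\<close>, but only the logarithms of these factors reach the number of
  copies. The size of the net is governed by the number of tabulated values, at most
  \<open>\<chi> * (d * \<chi> ^ degree)\<close> per vertex. Rooting at a leaf bounds every degree by
  \<open>2 * b\<close>, where \<open>b\<close> is the largest number of children, and this gives the
  exponent \<open>2 * b\<close> of \<chi>.\<close>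

lemma quad_form_insert:
  assumes "finite I" "k \<notin> I"
  shows "quad_form (insert k I) A x =
    cnj (x k) * A k k * x k + cnj (x k) * (\<Sum>j\<in>I. A k j * x j)
    + (\<Sum>i\<in>I. cnj (x i) * A i k) * x k + quad_form I A x"
  using assms
  by (simp add: quad_form_def sum.distrib sum_distrib_left sum_distrib_right mult.assoc add.assoc)

lemma quad_form_cong:
  assumes "\<And>i j. i \<in> I \<Longrightarrow> j \<in> I \<Longrightarrow> A i j = B i j" "\<And>i. i \<in> I \<Longrightarrow> x i = y i"
  shows "quad_form I A x = quad_form I B y"
  unfolding quad_form_def by (intro sum.cong refl) (simp add: assms)

lemma quad_form_mono_neutral:
  assumes "finite I" "J \<subseteq> I" "\<And>i. i \<in> I - J \<Longrightarrow> x i = 0"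
  shows "quad_form I A x = quad_form J A x"
proof -
  have "quad_form I A x = (\<Sum>i\<in>J. \<Sum>j\<in>I. cnj (x i) * A i j * x j)"
    unfolding quad_form_def using assms by (intro sum.mono_neutral_right) auto
  also have "\<dots> = quad_form J A x"
    unfolding quad_form_def using assms by (intro sum.cong sum.mono_neutral_right) auto
  finally show ?thesis .
qed

lemma psd_subset:
  assumes "finite I" "J \<subseteq> I" "psd I A"
  shows "psd J A"
  unfolding psd_def
proof
  fix x :: "'a \<Rightarrow> complex"
  define y where "y i = (if i \<in> J then x i else 0)" for i
  have "quad_form I A y = quad_form J A y"
    using assms by (intro quad_form_mono_neutral) (auto simp: y_def)
  also have "\<dots> = quad_form J A x"
    by (intro quad_form_cong) (auto simp: y_def)
  finally show "quad_form J A x \<in> \<real>\<^sub>\<ge>\<^sub>0"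
    using assms(3) by (metis psd_def)
qed

lemma psd_diag:
  assumes "finite I" "psd I A" "k \<in> I"
  shows "A k k \<in> \<real>\<^sub>\<ge>\<^sub>0"
proof -
  have "psd {k} A" using assms psd_subset[of I "{k}"] by auto
  then have "quad_form {k} A (\<lambda>_. 1) \<in> \<real>\<^sub>\<ge>\<^sub>0" by (simp add: psd_def)
  then show ?thesis by (simp add: quad_form_def)
qed

text \<open>Test vectors supported on two coordinates. Hermiticity and the vanishing of off-diagonal
  entries beside a zero diagonal entry are both read off these 2 by 2 principal blocks.\<close>

lemma psd_pair:
  assumes "finite I" "psd I A" "i \<in> I" "k \<in> I" "i \<noteq> k"
  shows "cnj s * A k k * s + cnj s * A k i * t + cnj t * A i k * s + cnj t * A i i * t \<in> \<real>\<^sub>\<ge>\<^sub>0"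
proof -
  have "psd {i,k} A" using assms psd_subset[of I "{i,k}"] by auto
  then have "quad_form {i,k} A (\<lambda>j. if j = i then t else s) \<in> \<real>\<^sub>\<ge>\<^sub>0" by (simp add: psd_def)
  then show ?thesis using assms(5) by (simp add: quad_form_def algebra_simps)
qed

text \<open>Polarisation: \<open>psd\<close> only says that all values of the form are nonnegative
  reals. The coordinates (1, 1) and (1, \<open>\<i>\<close>) on two basis elements compare the
  imaginary and the real parts of the two off-diagonal entries.\<close>

lemma psd_hermitian:
  assumes "finite I" "psd I A" "i \<in> I" "k \<in> I"
  shows "A i k = cnj (A k i)"
proof (cases "i = k")
  case True
  then show ?thesis using psd_diag[OF assms(1,2,4)]
    by (auto simp: complex_nonneg_Reals_iff complex_eq_iff)
next
  case False
  have d: "A k k \<in> \<real>\<^sub>\<ge>\<^sub>0" "A i i \<in> \<real>\<^sub>\<ge>\<^sub>0" by (rule psd_diag[OF assms(1,2)], fact)+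
  have 1: "Im (A k i + A i k) = 0"
    using psd_pair[OF assms False, of 1 1] d by (simp add: complex_nonneg_Reals_iff)
  have 2: "Re (A k i) - Re (A i k) = 0"
    using psd_pair[OF assms False, of 1 \<i>] d by (simp add: complex_nonneg_Reals_iff)
  show ?thesis using 1 2 by (simp add: complex_eq_iff)
qed

text \<open>With a zero at \<open>k\<close> the form has no quadratic term in that coordinate. The
  coordinates \<open>- c * cnj u\<close> at \<open>k\<close> and 1 at \<open>i\<close> give
  \<open>r - 2 * c * |u|^2\<close>, negative for large \<open>c\<close> unless
  \<open>u = 0\<close>.\<close>

lemma psd_zero_diag:
  assumes "finite I" "psd I A" "i \<in> I" "k \<in> I" "A k k = 0"
  shows "A i k = 0"
proof (cases "i = k")
  case False
  define r where "r = Re (A i i)"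
  have h: "A k i = cnj (A i k)" by (rule psd_hermitian[OF assms(1,2,4,3)])
  have r: "A i i = of_real r" "r \<ge> 0"
    using psd_diag[OF assms(1,2,3)] by (auto simp: r_def complex_nonneg_Reals_iff complex_eq_iff)
  define u where "u = A i k"
  have *: "- 2 * c * (cmod u)\<^sup>2 + r \<ge> 0" for c :: real
  proof -
    have "cnj (- of_real c * cnj u) * A k i + A i k * (- of_real c * cnj u) + A i i \<in> \<real>\<^sub>\<ge>\<^sub>0"
      using psd_pair[OF assms(1-4) False, of "- of_real c * cnj u" 1] assms(5) by simp
    also have "cnj (- of_real c * cnj u) * A k i + A i k * (- of_real c * cnj u) + A i i
      = of_real (- 2 * c * (cmod u)\<^sup>2 + r)"
      unfolding h u_def[symmetric] r(1) by (simp add: complex_norm_square algebra_simps del: of_real_power)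
    finally show ?thesis by (simp only: nonneg_Reals_of_real_iff)
  qed
  have "cmod u = 0"
  proof (rule ccontr)
    assume "cmod u \<noteq> 0"
    then have eq: "- 2 * ((r+1) / (cmod u)\<^sup>2) * (cmod u)\<^sup>2 + r = - r - 2" by simp
    have "- r - 2 \<ge> 0" using *[of "(r+1) / (cmod u)\<^sup>2"] by (simp only: eq)
    then show False using r(2) by linarith
  qed
  then show ?thesis by (simp add: u_def)
qed (use assms in simp)

text \<open>The vector \<open>y\<close> has at \<open>k\<close> the value that minimises the form
  over this coordinate, and the minimum is the form of the Schur complement.\<close>

lemma psd_schur_complement:
  assumes "finite I" "k \<notin> I" "psd (insert k I) A" "A k k \<noteq> 0"
  shows "psd I (\<lambda>i j. A i j - A i k * A k j / A k k)"
  unfolding psd_def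
proof
  fix x
  define y where "y = x(k := - (\<Sum>j\<in>I. A k j * x j) / A k k)"
  define R where "R = (\<Sum>j\<in>I. A k j * x j)"
  define C where "C = (\<Sum>i\<in>I. cnj (x i) * A i k)"
  have yk: "y k = - R / A k k" by (simp add: y_def R_def)
  have yI: "y i = x i" if "i \<in> I" for i using that assms(2) by (auto simp: y_def)
  have "quad_form I (\<lambda>i j. A i j - A i k * A k j / A k k) x
      = quad_form I A x - (\<Sum>i\<in>I. \<Sum>j\<in>I. (cnj (x i) * A i k) * (A k j * x j)) / A k k"
    by (simp add: quad_form_def algebra_simps sum_subtractf sum_divide_distrib)
  also have "(\<Sum>i\<in>I. \<Sum>j\<in>I. (cnj (x i) * A i k) * (A k j * x j)) = C * R"
    by (simp add: C_def R_def sum_product)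
  finally have 1: "quad_form I (\<lambda>i j. A i j - A i k * A k j / A k k) x = quad_form I A x - C * R / A k k" .
  have "quad_form (insert k I) A y = cnj (y k) * A k k * y k + cnj (y k) * R + C * y k + quad_form I A x"
    unfolding quad_form_insert[OF assms(1,2)]
    using quad_form_cong[of I A A y x] by (auto simp: yI R_def C_def cong: sum.cong)
  also have "\<dots> = quad_form I A x - C * R / A k k"
    using assms(4) by (simp add: yk field_simps)
  finally show "quad_form I (\<lambda>i j. A i j - A i k * A k j / A k k) x \<in> \<real>\<^sub>\<ge>\<^sub>0"
    using 1 assms(3) by (metis psd_def)
qed

text \<open>Cholesky elimination: subtracting a rank-one term clears row and column \<open>k\<close>
  and leaves a positive semidefinite remainder. Statements about mixed states thereby reduce to sums
  over unnormalised pure components.\<close>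

lemma psd_decomposition:
  assumes "finite I" "psd I A"
  shows "\<exists>v :: 'a \<Rightarrow> 'a \<Rightarrow> complex. \<forall>i\<in>I. \<forall>j\<in>I. A i j = (\<Sum>k\<in>I. v k i * cnj (v k j))"
  using assms
proof (induction I arbitrary: A rule: finite_induct)
  case (insert k I)
  have fin: "finite (insert k I)" using insert by simp
  have herm: "A i j = cnj (A j i)" if "i \<in> insert k I" "j \<in> insert k I" for i j
    using psd_hermitian[OF fin insert.prems that] .
  define r where "r = Re (A k k)"
  have r: "A k k = of_real r" "r \<ge> 0"
    using psd_diag[OF fin insert.prems, of k]
    by (auto simp: r_def complex_nonneg_Reals_iff complex_eq_iff)
  \<comment> \<open>When \<open>r = 0\<close>, division by zero makes \<open>u\<close> vanish, which
    is the right rank-one term since column \<open>k\<close> is then zero as well.\<close>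
  define u where "u i = A i k / of_real (sqrt r)" for i
  define B where "B i j = A i j - u i * cnj (u j)" for i j
  have sq: "complex_of_real (sqrt r) * complex_of_real (sqrt r) = of_real r"
    using r(2) by (simp flip: of_real_mult)
  have uu: "u i * cnj (u j) = A i k * A k j / A k k" if "j \<in> insert k I" for i j
    using herm[of k j] that sq r by (simp add: u_def)
  have Bk: "B i k = 0" "B k i = 0" if "i \<in> insert k I" for i
  proof -
    show "B i k = 0"
    proof (cases "A k k = 0")
      case True
      then show ?thesis using psd_zero_diag[OF fin insert.prems that, of k] by (simp add: B_def u_def)
    next
      case False
      then show ?thesis using uu[of k i] by (simp add: B_def)
    qed
    then have "cnj (B i k) = 0" by simp
    then show "B k i = 0" using herm[OF that, of k] by (simp add: B_def mult.commute)
  qed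
  have "psd I B"
  proof (cases "A k k = 0")
    case True
    have "quad_form I B x = quad_form I A x" for x
    proof (intro quad_form_cong)
      fix i j assume "i \<in> I"
      then have "A i k = 0" using psd_zero_diag[OF fin insert.prems] True by auto
      then show "B i j = A i j" by (simp add: B_def u_def)
    qed simp
    then show ?thesis using psd_subset[OF fin _ insert.prems, of I] by (auto simp: psd_def)
  next
    case False
    have "quad_form I B x = quad_form I (\<lambda>i j. A i j - A i k * A k j / A k k) x" for x
      by (intro quad_form_cong) (auto simp: B_def uu)
    then show ?thesis using psd_schur_complement[OF insert.hyps insert.prems False] by (simp add: psd_def)
  qed
  then obtain v where v: "\<And>i j. i \<in> I \<Longrightarrow> j \<in> I \<Longrightarrow> B i j = (\<Sum>l\<in>I. v l i * cnj (v l j))"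
    using insert.IH by blast
  define w where "w l = (if l = k then u else (v l)(k := 0))" for l
  have "A i j = (\<Sum>l\<in>insert k I. w l i * cnj (w l j))" if ij: "i \<in> insert k I" "j \<in> insert k I" for i j
  proof -
    have "(\<Sum>l\<in>insert k I. w l i * cnj (w l j)) = u i * cnj (u j) + (\<Sum>l\<in>I. w l i * cnj (w l j))"
      using insert.hyps by (simp add: w_def)
    also have "(\<Sum>l\<in>I. w l i * cnj (w l j)) = B i j"
    proof (cases "i = k \<or> j = k")
      case True
      then have "(\<Sum>l\<in>I. w l i * cnj (w l j)) = 0"
        using insert.hyps by (intro sum.neutral) (auto simp: w_def)
      then show ?thesis using True Bk ij by auto
    next
      case False
      then have "(\<Sum>l\<in>I. w l i * cnj (w l j)) = (\<Sum>l\<in>I. v l i * cnj (v l j))"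
        using insert.hyps by (intro sum.cong) (auto simp: w_def)
      then show ?thesis using v False ij by auto
    qed
    finally show ?thesis by (simp add: B_def)
  qed
  then show ?case by blast
qed simp

section \<open>A four-moment frame\<close>

text \<open>All eight indices are equally likely. The squared modulus is 2 or 0 with probability 1/2
  each, so its first three moments are 1, 2, 4, against 1, 2, 6 for a complex Gaussian. With fourth
  roots of unity as phases, the mean of \<open>z ^ a * cnj z ^ b\<close> vanishes for distinct
  \<open>a, b \<le> 3\<close>, which covers every mixed term up to the sixth moment.\<close>

definition letter :: "nat \<Rightarrow> complex" where
  "letter y = (if y < 4 then of_real (sqrt 2) * \<i> ^ y else 0)"

definition words :: "'i set \<Rightarrow> ('i \<Rightarrow> nat) set" where
  "words I = I \<rightarrow>\<^sub>E {..<8}"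

definition avg :: "'i set \<Rightarrow> (('i \<Rightarrow> nat) \<Rightarrow> 'b) \<Rightarrow> 'b::real_vector" where
  "avg I f = (\<Sum>a\<in>words I. f a) /\<^sub>R 8 ^ card I"

definition amp :: "'i set \<Rightarrow> ('i \<Rightarrow> complex) \<Rightarrow> ('i \<Rightarrow> nat) \<Rightarrow> complex" where
  "amp I c a = (\<Sum>i\<in>I. c i * letter (a i))"

definition sqn :: "'i set \<Rightarrow> ('i \<Rightarrow> complex) \<Rightarrow> real" where
  "sqn I c = (\<Sum>i\<in>I. (cmod (c i))\<^sup>2)"

lemma finite_words: "finite I \<Longrightarrow> finite (words I)"
  by (simp add: words_def finite_PiE)

lemma avg_empty: "avg {} f = f (\<lambda>_. undefined)"
  by (simp add: avg_def words_def)

text \<open>Coordinates of a uniform word are independent, so the letter at \<open>k\<close> may be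
  averaged separately. All moments below are inductions on \<open>I\<close> through this
  identity.\<close>

lemma avg_insert:
  assumes "finite I" "k \<notin> I"
  shows "avg (insert k I) f = avg I (\<lambda>a. (\<Sum>y<8. f (a(k := y))) /\<^sub>R 8)"
proof -
  have "(\<Sum>a\<in>words (insert k I). f a) = (\<Sum>(y, a)\<in>{..<8} \<times> words I. f (a(k := y)))"
    unfolding words_def PiE_insert_eq
    using inj_combinator[OF assms(2), of "\<lambda>_. {..<8::nat}"]
    by (subst sum.reindex) (auto simp: case_prod_unfold)
  also have "\<dots> = (\<Sum>a\<in>words I. \<Sum>y<8. f (a(k := y)))"
    by (subst sum.cartesian_product[symmetric]) (rule sum.swap)
  finally show ?thesis
    using assms by (simp add: avg_def scaleR_sum_right[symmetric])
qed

lemma avg_mono: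
  fixes f g :: "('i \<Rightarrow> nat) \<Rightarrow> real"
  shows "(\<And>a. a \<in> words I \<Longrightarrow> f a \<le> g a) \<Longrightarrow> avg I f \<le> avg I g"
  by (simp add: avg_def sum_mono)

lemma avg_add: "avg I (\<lambda>a. f a + g a) = avg I f + avg I g"
  by (simp add: avg_def sum.distrib scaleR_add_right)

lemma avg_linear: "linear h \<Longrightarrow> avg I (\<lambda>a. h (f a)) = h (avg I f)"
  by (simp add: avg_def linear_sum linear_cmul)

lemma avg_mult_left: 
  fixes f :: "('i \<Rightarrow> nat) \<Rightarrow> 'b::real_algebra"
  shows "avg I (\<lambda>a. r * f a) = r * avg I f"
  by (simp add: avg_def sum_distrib_left[symmetric])

lemma avg_mult_right: 
  fixes f :: "('i \<Rightarrow> nat) \<Rightarrow> 'b::real_algebra"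
  shows "avg I (\<lambda>a. f a * r) = avg I f * r"
  by (simp add: avg_def sum_distrib_right[symmetric])

lemma avg_const: 
  fixes r :: "'b::real_vector"
  shows "finite I \<Longrightarrow> avg I (\<lambda>a. r) = r"
  by (simp add: avg_def words_def card_PiE sum_constant_scaleR)

lemma avg_sum: "avg I (\<lambda>a. \<Sum>k\<in>K. f k a) = (\<Sum>k\<in>K. avg I (f k))"
  unfolding avg_def by (subst sum.swap) (simp add: scaleR_sum_right)

lemma amp_insert:
  assumes "finite I" "k \<notin> I"
  shows "amp (insert k I) c (a(k := y)) = amp I c a + c k * letter y"
proof -
  have "(\<Sum>i\<in>I. c i * letter ((a(k := y)) i)) = amp I c a"
    unfolding amp_def using assms by (intro sum.cong) auto
  then show ?thesis using assms by (simp add: amp_def)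
qed

lemma sum_letters:
  "(\<Sum>y<8. f (letter y)) = f (of_real (sqrt 2)) + f (of_real (sqrt 2) * \<i>)
     + f (- of_real (sqrt 2)) + f (- (of_real (sqrt 2) * \<i>)) + f 0 + f 0 + f 0 + f 0"
proof -
  have "{..<8::nat} = {0,1,2,3,4,5,6,7}" by auto
  moreover have "\<i>^3 = -\<i>" by (simp add: power3_eq_cube)
  ultimately show ?thesis
    by (simp add: letter_def add_ac)
qed

text \<open>Letters have mean zero and mean squared modulus one, so only the diagonal terms survive.
  This is the resolution of the identity behind the POVM.\<close>

lemma avg_amp_product:
  assumes "finite I"
  shows "avg I (\<lambda>a. amp I c a * cnj (amp I e a)) = (\<Sum>i\<in>I. c i * cnj (e i))"
  using assms
proof (induction I rule: finite_induct)
  case empty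
  show ?case by (simp add: avg_empty amp_def)
next
  case (insert k I)
  have s: "complex_of_real (sqrt 2) * complex_of_real (sqrt 2) = 2"
    by (simp flip: of_real_mult)
  have "(\<Sum>y<8. (z + p * letter y) * cnj (w + q * letter y)) /\<^sub>R 8 = z * cnj w + p * cnj q" for z w p q
    unfolding sum_letters[of "\<lambda>t. (z + p * t) * cnj (w + q * t)"]
    using s by (simp add: algebra_simps scaleR_conv_of_real)
  then show ?case
    using insert by (simp add: avg_insert amp_insert avg_add avg_const add.commute)
qed

lemma avg_amp_sq:
  assumes "finite I"
  shows "avg I (\<lambda>a. (cmod (amp I c a))\<^sup>2) = sqn I c"
proof -
  have "complex_of_real (avg I (\<lambda>a. (cmod (amp I c a))\<^sup>2)) = avg I (\<lambda>a. of_real ((cmod (amp I c a))\<^sup>2))"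
    by (simp add: avg_def scaleR_conv_of_real)
  also have "\<dots> = (\<Sum>i\<in>I. c i * cnj (c i))"
    using avg_amp_product[OF assms, of c c] by (simp only: complex_norm_square)
  also have "\<dots> = of_real (sqn I c)" by (simp add: sqn_def complex_norm_square del: of_real_power)
  finally show ?thesis by (simp only: of_real_eq_iff)
qed

lemma letter_avg_fourth:
  "(\<Sum>y<8. (cmod (z + p * letter y))\<^sup>2 * (cmod (w + q * letter y))\<^sup>2) /\<^sub>R 8 =
    (cmod z)\<^sup>2 * (cmod w)\<^sup>2 + (cmod z)\<^sup>2 * (cmod q)\<^sup>2 + (cmod w)\<^sup>2 * (cmod p)\<^sup>2
    + 2 * (cmod p)\<^sup>2 * (cmod q)\<^sup>2 + 2 * Re (z * cnj w * (cnj p * q))"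
proof -
  define s where "s = sqrt 2"
  have s: "s * s = 2" by (simp add: s_def)
  have s': "s * (s * x) = 2 * x" for x using s by (simp flip: mult.assoc)
  show ?thesis
    unfolding sum_letters[of "\<lambda>t. (cmod (z + p * t))\<^sup>2 * (cmod (w + q * t))\<^sup>2"] s_def[symmetric]
    unfolding cmod_power2
    by (simp add: power2_eq_square algebra_simps s s')
qed

text \<open>The coefficients are the squared binomials 1, 9, 9, 1 times the moments 1, 1, 2, 4 of
  the squared modulus of a letter.\<close>

lemma letter_avg_sixth:
  "(\<Sum>y<8. ((cmod (z + p * letter y))\<^sup>2) ^ 3) /\<^sub>R 8 =
    ((cmod z)\<^sup>2)^3 + 9 * ((cmod z)\<^sup>2)^2 * (cmod p)\<^sup>2 + 18 * (cmod z)\<^sup>2 * ((cmod p)\<^sup>2)^2 + 4 * ((cmod p)\<^sup>2)^3"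
proof -
  define s where "s = sqrt 2"
  have s: "s * s = 2" by (simp add: s_def)
  have s': "s * (s * x) = 2 * x" for x using s by (simp flip: mult.assoc)
  show ?thesis
    unfolding sum_letters[of "\<lambda>t. ((cmod (z + p * t))\<^sup>2)^3"] s_def[symmetric]
    unfolding cmod_power2
    by (simp add: power2_eq_square power3_eq_cube algebra_simps s s')
qed

text \<open>The Gaussian formula with two pairings: each vector with itself, or the two crosswise.
  The crossed pairing is what carries the fidelity.\<close>

lemma avg_amp_fourth:
  assumes "finite I"
  shows "avg I (\<lambda>a. (cmod (amp I c a))\<^sup>2 * (cmod (amp I e a))\<^sup>2) =
    sqn I c * sqn I e + (cmod (\<Sum>i\<in>I. c i * cnj (e i)))\<^sup>2"
  using assms
proof (induction I rule: finite_induct)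
  case empty
  show ?case by (simp add: avg_empty amp_def sqn_def)
next
  case (insert k I)
  define S where "S = (\<Sum>i\<in>I. c i * cnj (e i))"
  have re: "avg I (\<lambda>a. Re (amp I c a * cnj (amp I e a) * t)) = Re (S * t)" for t
    using avg_linear[of Re I "\<lambda>a. amp I c a * cnj (amp I e a) * t"] avg_amp_product[OF insert.hyps(1), of c e]
    by (simp add: bounded_linear.linear[OF bounded_linear_Re] avg_mult_right S_def)
  have "avg (insert k I) (\<lambda>a. (cmod (amp (insert k I) c a))\<^sup>2 * (cmod (amp (insert k I) e a))\<^sup>2) =
     sqn I c * sqn I e + (cmod S)\<^sup>2 + sqn I c * (cmod (e k))\<^sup>2 + sqn I e * (cmod (c k))\<^sup>2
       + 2 * (cmod (c k))\<^sup>2 * (cmod (e k))\<^sup>2 + 2 * Re (S * (cnj (c k) * e k))"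
    unfolding avg_insert[OF insert.hyps] amp_insert[OF insert.hyps] letter_avg_fourth
    by (simp only: avg_add avg_mult_left avg_mult_right re insert.IH avg_amp_sq[OF insert.hyps(1)] avg_const[OF insert.hyps(1)] S_def)
  also have "\<dots> = (sqn I c + (cmod (c k))\<^sup>2) * (sqn I e + (cmod (e k))\<^sup>2) + (cmod (S + c k * cnj (e k)))\<^sup>2"
    unfolding cmod_power2 by (simp add: algebra_simps power2_eq_square)
  finally show ?case
    using insert.hyps by (simp add: sqn_def S_def add.commute)
qed

text \<open>A Gaussian would give equality. Only the pure sixth moment of a letter falls short, 4
  instead of 6; raising it to 6 completes the cube \<open>6 * (s + P) ^ 3\<close>.\<close>

lemma avg_amp_sixth:
  assumes "finite I"
  shows "avg I (\<lambda>a. ((cmod (amp I c a))\<^sup>2) ^ 3) \<le> 6 * sqn I c ^ 3"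
  using assms
proof (induction I rule: finite_induct)
  case empty
  show ?case by (simp add: avg_empty amp_def sqn_def)
next
  case (insert k I)
  have four: "avg I (\<lambda>a. ((cmod (amp I c a))\<^sup>2) ^ 2) = 2 * (sqn I c)\<^sup>2"
  proof -
    have "(\<Sum>i\<in>I. c i * cnj (c i)) = of_real (sqn I c)"
      by (simp add: sqn_def complex_norm_square del: of_real_power)
    moreover have "sqn I c \<ge> 0" by (simp add: sqn_def sum_nonneg)
    ultimately show ?thesis
      using avg_amp_fourth[OF insert.hyps(1), of c c] by (simp add: power2_eq_square)
  qed
  define P where "P = (cmod (c k))\<^sup>2"
  define s where "s = sqn I c"
  have nn: "P \<ge> 0" "s \<ge> 0" by (simp_all add: P_def s_def sqn_def sum_nonneg)
  have "avg (insert k I) (\<lambda>a. ((cmod (amp (insert k I) c a))\<^sup>2) ^ 3) =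
     avg I (\<lambda>a. ((cmod (amp I c a))\<^sup>2) ^ 3) + 9 * (2 * s\<^sup>2) * P + 18 * s * P\<^sup>2 + 4 * P^3"
    unfolding avg_insert[OF insert.hyps] amp_insert[OF insert.hyps] letter_avg_sixth
    by (simp only: avg_add avg_mult_left avg_mult_right four avg_amp_sq[OF insert.hyps(1)] avg_const[OF insert.hyps(1)] P_def s_def)
  also have "\<dots> \<le> 6 * s^3 + 9 * (2 * s\<^sup>2) * P + 18 * s * P\<^sup>2 + 6 * P^3"
    using insert.IH zero_le_power[OF nn(1), of 3] by (simp only: s_def)
  also have "\<dots> = 6 * (s + P)^3"
    by (simp add: power3_eq_cube power2_eq_square algebra_simps)
  finally show ?case
    using insert.hyps by (simp add: sqn_def s_def P_def add.commute)
qed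

text \<open>The weighted arithmetic-geometric mean inequality reduces the mixed moment to the two
  pure ones. Scaling by \<open>s\<close> keeps the bound linear in \<open>sqn I c\<close>, so that
  it can be summed over the components of a density operator.\<close>

lemma avg_amp_mixed_sixth:
  assumes "finite I" "sqn I e = 1"
  shows "avg I (\<lambda>a. (cmod (amp I c a))\<^sup>2 * ((cmod (amp I e a))\<^sup>2)\<^sup>2) \<le> 6 * sqn I c"
proof (cases "sqn I c = 0")
  case True
  then have "\<forall>i\<in>I. c i = 0" using assms(1) by (simp add: sqn_def sum_nonneg_eq_0_iff)
  then have "amp I c a = 0" for a by (simp add: amp_def)
  then show ?thesis using True by (simp add: avg_def)
next
  case False
  define s where "s = sqn I c"
  have s: "s > 0" using False by (simp add: s_def sqn_def sum_nonneg order_less_le)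
  have young: "y * z\<^sup>2 \<le> s * ((1 / (3 * s^3)) * y^3 + (2/3) * z^3)" if "y \<ge> 0" "z \<ge> 0" for y z :: real
  proof -
    define x where "x = y / s"
    have y: "y = s * x" using s by (simp add: x_def)
    \<comment> \<open>The product expands to \<open>x^3 - 3 * x * z^2 + 2 * z^3\<close>.\<close>
    have "0 \<le> (x - z)\<^sup>2 * (x + 2 * z)" using that s by (simp add: x_def)
    then have "x * z\<^sup>2 \<le> (1/3) * x^3 + (2/3) * z^3"
      by (simp add: power2_eq_square power3_eq_cube algebra_simps)
    then have "s * (x * z\<^sup>2) \<le> s * ((1/3) * x^3 + (2/3) * z^3)" using s by simp
    also have "(1/3) * x^3 = (1 / (3 * s^3)) * y^3" using s by (simp add: y power_mult_distrib)
    finally show ?thesis by (simp add: y)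
  qed
  have "avg I (\<lambda>a. (cmod (amp I c a))\<^sup>2 * ((cmod (amp I e a))\<^sup>2)\<^sup>2)
    \<le> avg I (\<lambda>a. s * ((1 / (3 * s^3)) * ((cmod (amp I c a))\<^sup>2)^3 + (2/3) * ((cmod (amp I e a))\<^sup>2)^3))"
    by (intro avg_mono young) auto
  also have "\<dots> = s * ((1 / (3 * s^3)) * avg I (\<lambda>a. ((cmod (amp I c a))\<^sup>2)^3)
      + (2/3) * avg I (\<lambda>a. ((cmod (amp I e a))\<^sup>2)^3))"
    by (simp only: avg_add avg_mult_left)
  also have "\<dots> \<le> s * ((1 / (3 * s^3)) * (6 * s^3) + (2/3) * (6 * 1^3))"
    using avg_amp_sixth[OF assms(1), of c] avg_amp_sixth[OF assms(1), of e] s assms(2)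
    by (intro mult_left_mono add_mono) (auto simp: s_def)
  also have "\<dots> = 6 * s" using s by simp
  finally show ?thesis by (simp add: s_def)
qed

section \<open>Learning from a finite hypothesis class\<close>

lemma sum_prod_PiE:
  fixes f :: "'k \<Rightarrow> 'a \<Rightarrow> 'b::comm_semiring_1"
  assumes "finite K" "finite A"
  shows "(\<Sum>g\<in>K \<rightarrow>\<^sub>E A. \<Prod>k\<in>K. f k (g k)) = (\<Prod>k\<in>K. \<Sum>a\<in>A. f k a)"
  using prod_sum_PiE[OF assms(1), of "\<lambda>_. A" f] assms(2) by simp

lemma sum_rotate:
  "(\<Sum>i\<in>A. \<Sum>j\<in>B. \<Sum>k\<in>C. f i j k) = (\<Sum>k\<in>C. \<Sum>i\<in>A. \<Sum>j\<in>B. f i j k)"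
proof -
  have "(\<Sum>i\<in>A. \<Sum>j\<in>B. \<Sum>k\<in>C. f i j k) = (\<Sum>i\<in>A. \<Sum>k\<in>C. \<Sum>j\<in>B. f i j k)"
    by (intro sum.cong refl sum.swap)
  also have "\<dots> = (\<Sum>k\<in>C. \<Sum>i\<in>A. \<Sum>j\<in>B. f i j k)"
    by (rule sum.swap)
  finally show ?thesis .
qed

lemma sum_UNION_le:
  fixes P :: "'a \<Rightarrow> real"
  assumes "finite A" "\<And>i. i \<in> A \<Longrightarrow> finite (D i)" "\<And>x. P x \<ge> 0"
  shows "sum P (\<Union>i\<in>A. D i) \<le> (\<Sum>i\<in>A. sum P (D i))"
  using assms
proof (induction A rule: finite_induct)
  case (insert i A)
  have "sum P (D i \<union> (\<Union>i\<in>A. D i)) \<le> sum P (D i) + sum P (\<Union>i\<in>A. D i)"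
    using insert sum.union_inter[of "D i" "\<Union>i\<in>A. D i" P] sum_nonneg[of "D i \<inter> (\<Union>i\<in>A. D i)" P] by simp
  then show ?case using insert by fastforce
qed simp

text \<open>For negative \<open>u = - w\<close>, the lower Taylor bound for \<open>exp w\<close> is
  inverted: its product with \<open>1 - w + w^2\<close> is at least 1.\<close>

lemma exp_quadratic_upper:
  fixes u :: real
  assumes "\<bar>u\<bar> \<le> 1"
  shows "exp u \<le> 1 + u + u\<^sup>2"
proof (cases "u \<ge> 0")
  case True
  then show ?thesis using exp_bound assms by auto
next
  case False
  define w where "w = - u"
  have w: "w \<ge> 0" using False by (simp add: w_def)
  have "1 \<le> (1 - w + w\<^sup>2) * (1 + w + w\<^sup>2 / 2)"
  proof -
    have "(1 - w + w\<^sup>2) * (1 + w + w\<^sup>2 / 2) = 1 + (w^2 + w^3 + w^4) / 2"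
      by (simp add: field_simps power2_eq_square power3_eq_cube power4_eq_xxxx)
    then show ?thesis using w by simp
  qed
  also have "\<dots> \<le> (1 - w + w\<^sup>2) * exp w"
    using assms w by (intro mult_left_mono exp_lower_Taylor_quadratic) (auto simp: w_def)
  finally have "1 * exp (-w) \<le> (1 - w + w\<^sup>2) * exp w * exp (-w)"
    by (intro mult_right_mono) auto
  also have "\<dots> = 1 - w + w\<^sup>2" by (simp add: mult.assoc flip: exp_add)
  finally show ?thesis by (simp add: w_def)
qed

text \<open>Exponential Markov inequality. The second moment \<open>W\<close> enters the exponent
  while the range \<open>B\<close> only limits the modulus of \<open>s\<close>; the sign of
  \<open>s\<close> selects the tail, so one statement serves both.\<close>

lemma chernoff_finite:
  fixes q Y :: "'a \<Rightarrow> real"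
  assumes fin: "finite A" and q: "\<And>a. a \<in> A \<Longrightarrow> q a \<ge> 0" "(\<Sum>a\<in>A. q a) = 1"
    and Y: "\<And>a. a \<in> A \<Longrightarrow> Y a \<in> {0..B}" and mu: "\<mu> = (\<Sum>a\<in>A. q a * Y a)"
    and var: "(\<Sum>a\<in>A. q a * (Y a)\<^sup>2) \<le> W" and s: "\<bar>s\<bar> * B \<le> 1"
  shows "(\<Sum>g\<in>{g\<in>{..<N} \<rightarrow>\<^sub>E A. s * (\<Sum>k<N. Y (g k)) \<ge> real N * (s * \<mu> + \<tau>)}. \<Prod>k<N. q (g k))
    \<le> exp (real N * (W * s\<^sup>2 - \<tau>))"
proof -
  have mu_range: "\<mu> \<in> {0..B}"
  proof -
    have "\<mu> \<le> (\<Sum>a\<in>A. q a * B)" unfolding mu using q Y by (intro sum_mono mult_left_mono) auto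
    then show ?thesis using q Y unfolding mu by (auto simp flip: sum_distrib_right intro!: sum_nonneg)
  qed
  have one: "(\<Sum>a\<in>A. q a * exp (s * (Y a - \<mu>) - \<tau>)) \<le> exp (W * s\<^sup>2 - \<tau>)"
  proof -
    have "(\<Sum>a\<in>A. q a * exp (s * (Y a - \<mu>))) \<le> (\<Sum>a\<in>A. q a * (1 + s * (Y a - \<mu>) + (s * (Y a - \<mu>))\<^sup>2))"
    proof (intro sum_mono mult_left_mono exp_quadratic_upper q)
      fix a assume "a \<in> A"
      then have "\<bar>Y a - \<mu>\<bar> \<le> B" using Y[of a] mu_range by auto
      then have "\<bar>s\<bar> * \<bar>Y a - \<mu>\<bar> \<le> \<bar>s\<bar> * B" by (intro mult_left_mono) auto
      then show "\<bar>s * (Y a - \<mu>)\<bar> \<le> 1" using s by (simp add: abs_mult)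
    qed
    also have "\<dots> = (\<Sum>a\<in>A. (1 - s * \<mu> + s\<^sup>2 * \<mu>\<^sup>2) * q a + (s - 2 * s\<^sup>2 * \<mu>) * (q a * Y a) + s\<^sup>2 * (q a * (Y a)\<^sup>2))"
      by (intro sum.cong) (auto simp: power2_eq_square algebra_simps)
    also have "\<dots> = (1 - s * \<mu> + s\<^sup>2 * \<mu>\<^sup>2) + (s - 2 * s\<^sup>2 * \<mu>) * \<mu> + s\<^sup>2 * (\<Sum>a\<in>A. q a * (Y a)\<^sup>2)"
      by (simp add: sum.distrib q(2) mu flip: sum_distrib_left)
    also have "\<dots> = 1 + s\<^sup>2 * ((\<Sum>a\<in>A. q a * (Y a)\<^sup>2) - \<mu>\<^sup>2)"
      by (simp add: power2_eq_square algebra_simps)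
    also have "\<dots> \<le> 1 + s\<^sup>2 * W"
    proof -
      have "(\<Sum>a\<in>A. q a * (Y a)\<^sup>2) - \<mu>\<^sup>2 \<le> W"
        using var zero_le_power2[of \<mu>] by linarith
      then show ?thesis by (intro add_left_mono mult_left_mono) auto
    qed
    also have "\<dots> \<le> exp (W * s\<^sup>2)" using exp_ge_add_one_self[of "W * s\<^sup>2"] by (simp add: mult.commute)
    finally have "(\<Sum>a\<in>A. q a * exp (s * (Y a - \<mu>))) * exp (- \<tau>) \<le> exp (W * s\<^sup>2) * exp (- \<tau>)"
      by (intro mult_right_mono) auto
    then show ?thesis by (simp add: sum_distrib_right mult.assoc flip: exp_add)
  qed
  have "(\<Sum>g\<in>{g\<in>{..<N} \<rightarrow>\<^sub>E A. s * (\<Sum>k<N. Y (g k)) \<ge> real N * (s * \<mu> + \<tau>)}. \<Prod>k<N. q (g k))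
    \<le> (\<Sum>g\<in>{g\<in>{..<N} \<rightarrow>\<^sub>E A. s * (\<Sum>k<N. Y (g k)) \<ge> real N * (s * \<mu> + \<tau>)}.
         \<Prod>k<N. q (g k) * exp (s * (Y (g k) - \<mu>) - \<tau>))"
  proof (intro sum_mono)
    fix g assume g: "g \<in> {g\<in>{..<N} \<rightarrow>\<^sub>E A. s * (\<Sum>k<N. Y (g k)) \<ge> real N * (s * \<mu> + \<tau>)}"
    have "(\<Prod>k<N. exp (s * (Y (g k) - \<mu>) - \<tau>)) = exp (\<Sum>k<N. s * (Y (g k) - \<mu>) - \<tau>)"
      by (simp add: exp_sum)
    also have "(\<Sum>k<N. s * (Y (g k) - \<mu>) - \<tau>) = s * (\<Sum>k<N. Y (g k)) - real N * (s * \<mu> + \<tau>)"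
      by (simp add: sum_subtractf algebra_simps flip: sum_distrib_left)
    finally have "1 \<le> (\<Prod>k<N. exp (s * (Y (g k) - \<mu>) - \<tau>))" using g by simp
    moreover have "0 \<le> (\<Prod>k<N. q (g k))" using g q by (intro prod_nonneg) (auto dest: PiE_mem)
    ultimately show "(\<Prod>k<N. q (g k)) \<le> (\<Prod>k<N. q (g k) * exp (s * (Y (g k) - \<mu>) - \<tau>))"
      by (simp add: prod.distrib mult_le_cancel_left1)
  qed
  also have "\<dots> \<le> (\<Sum>g\<in>{..<N} \<rightarrow>\<^sub>E A. \<Prod>k<N. q (g k) * exp (s * (Y (g k) - \<mu>) - \<tau>))"
    using fin q by (intro sum_mono2) (auto intro!: finite_PiE prod_nonneg dest: PiE_mem)
  also have "\<dots> = (\<Sum>a\<in>A. q a * exp (s * (Y a - \<mu>) - \<tau>)) ^ N"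
    using sum_prod_PiE[of "{..<N}" A "\<lambda>_ a. q a * exp (s * (Y a - \<mu>) - \<tau>)"] fin by simp
  also have "\<dots> \<le> exp (W * s\<^sup>2 - \<tau>) ^ N"
    using one q by (intro power_mono sum_nonneg mult_nonneg_nonneg) auto
  also have "\<dots> = exp (real N * (W * s\<^sup>2 - \<tau>))" by (simp flip: exp_of_nat_mult)
  finally show ?thesis .
qed

section \<open>The frame measurement\<close>

definition frame_op :: "'i set \<Rightarrow> ('i \<Rightarrow> nat) \<Rightarrow> 'i \<Rightarrow> 'i \<Rightarrow> complex" where
  "frame_op I a x y = letter (a x) * cnj (letter (a y)) / 8 ^ card I"

definition frame_power :: "'i set \<Rightarrow> nat \<Rightarrow> (nat \<Rightarrow> 'i \<Rightarrow> nat) \<Rightarrow> (nat \<Rightarrow> 'i) \<Rightarrow> (nat \<Rightarrow> 'i) \<Rightarrow> complex" where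
  "frame_power I N g x y = (\<Prod>k<N. frame_op I (g k) (x k) (y k))"

definition frame_prob :: "'i set \<Rightarrow> ('i \<Rightarrow> 'i \<Rightarrow> complex) \<Rightarrow> ('i \<Rightarrow> nat) \<Rightarrow> real" where
  "frame_prob I \<rho> a = Re (trace_on I (op_mult I (frame_op I a) \<rho>))"

text \<open>\<open>amp\<close> is bilinear, hence the conjugate: this is the squared modulus of the
  inner product of \<open>h\<close> with the frame vector labelled \<open>a\<close>.\<close>

definition overlap :: "'i set \<Rightarrow> ('i \<Rightarrow> complex) \<Rightarrow> ('i \<Rightarrow> nat) \<Rightarrow> real" where
  "overlap I h a = (cmod (amp I (\<lambda>i. cnj (h i)) a))\<^sup>2"

lemma amp_delta:
  assumes "finite I" "x \<in> I"
  shows "amp I (\<lambda>i. if i = x then 1 else 0) a = letter (a x)"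
proof -
  have "amp I (\<lambda>i. if i = x then 1 else 0) a = (\<Sum>i\<in>I. if i = x then letter (a i) else 0)"
    unfolding amp_def by (intro sum.cong) auto
  then show ?thesis using assms by simp
qed

lemma sum_frame_op:
  assumes "finite I" "x \<in> I" "y \<in> I"
  shows "(\<Sum>a\<in>words I. frame_op I a x y) = (if x = y then 1 else 0)"
proof -
  have "(\<Sum>a\<in>words I. frame_op I a x y) = avg I (\<lambda>a. letter (a x) * cnj (letter (a y)))"
    by (simp add: avg_def frame_op_def scaleR_conv_of_real sum_divide_distrib divide_inverse mult.commute sum_distrib_left)
  also have "\<dots> = (\<Sum>i\<in>I. (if i = x then 1 else 0) * cnj (if i = y then 1 else 0))"
    using avg_amp_product[OF assms(1), of "\<lambda>i. if i = x then 1 else 0" "\<lambda>i. if i = y then 1 else 0"]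
    by (simp add: amp_delta assms)
  also have "\<dots> = (\<Sum>i\<in>I. if i = x then if x = y then 1 else 0 else 0)"
    by (intro sum.cong) auto
  finally show ?thesis using assms by simp
qed

text \<open>Each copy is measured separately. A product of rank-one operators is again rank one, and
  completeness factorises over the copies.\<close>

lemma povm_frame_power:
  assumes "finite I"
  shows "povm (copies_basis N I) (copies_basis N (words I)) (frame_power I N)"
  unfolding povm_def
proof (intro conjI ballI)
  show "finite (copies_basis N (words I))"
    using assms by (simp add: copies_basis_def finite_PiE finite_words)
next
  fix g :: "nat \<Rightarrow> 'a \<Rightarrow> nat"
  define G where "G x = (\<Prod>k<N. letter (g k (x k)))" for x
  define w :: real where "w = (1 / 8 ^ card I) ^ N"
  have fp: "frame_power I N g x y = of_real w * (G x * cnj (G y))" for x y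
    by (simp add: frame_power_def frame_op_def G_def w_def prod.distrib divide_inverse mult_ac power_inverse flip: power_mult)
  show "psd (copies_basis N I) (frame_power I N g)"
    unfolding psd_def
  proof
    fix x
    define S where "S = (\<Sum>i\<in>copies_basis N I. cnj (x i) * G i)"
    have "quad_form (copies_basis N I) (frame_power I N g) x
      = of_real w * (\<Sum>i\<in>copies_basis N I. \<Sum>j\<in>copies_basis N I. (cnj (x i) * G i) * cnj (cnj (x j) * G j))"
      unfolding quad_form_def fp sum_distrib_left by (intro sum.cong) (auto simp: mult_ac)
    also have "\<dots> = of_real w * (S * cnj S)"
      by (simp add: S_def sum_product)
    also have "\<dots> = of_real (w * (cmod S)\<^sup>2)"
      by (simp only: complex_norm_square of_real_mult)
    finally show "quad_form (copies_basis N I) (frame_power I N g) x \<in> \<real>\<^sub>\<ge>\<^sub>0"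
      by (simp add: w_def)
  qed
next
  fix x y assume xy: "x \<in> copies_basis N I" "y \<in> copies_basis N I"
  have "(\<Sum>g\<in>copies_basis N (words I). frame_power I N g x y)
    = (\<Prod>k<N. \<Sum>a\<in>words I. frame_op I a (x k) (y k))"
    unfolding frame_power_def copies_basis_def
    using assms by (intro sum_prod_PiE) (auto simp: finite_words)
  also have "\<dots> = (\<Prod>k<N. if x k = y k then 1 else 0)"
    using assms xy by (intro prod.cong refl sum_frame_op) (auto simp: copies_basis_def)
  also have "\<dots> = (if x = y then 1 else 0)"
  proof (cases "x = y")
    case False
    then obtain k where "k < N" "x k \<noteq> y k"
      using xy PiE_ext[of x "{..<N}" "\<lambda>_. I" y] by (auto simp: copies_basis_def)
    then show ?thesis using False by auto
  qed simp
  finally show "(\<Sum>g\<in>copies_basis N (words I). frame_power I N g x y) = (if x = y then 1 else 0)" .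
qed

section \<open>Outcome statistics of the frame\<close>

context
  fixes I :: "'i set" and \<rho> :: "'i \<Rightarrow> 'i \<Rightarrow> complex" and v :: "'i \<Rightarrow> 'i \<Rightarrow> complex"
  assumes fin: "finite I"
    and dec: "\<forall>i\<in>I. \<forall>j\<in>I. \<rho> i j = (\<Sum>k\<in>I. v k i * cnj (v k j))"
begin

lemma trace_decomposition: "trace_on I \<rho> = of_real (\<Sum>k\<in>I. sqn I (v k))"
proof -
  have "trace_on I \<rho> = (\<Sum>i\<in>I. \<Sum>k\<in>I. v k i * cnj (v k i))"
    by (simp add: trace_on_def dec)
  also have "\<dots> = of_real (\<Sum>k\<in>I. sqn I (v k))"
    by (subst sum.swap) (simp add: sqn_def complex_norm_square del: of_real_power)
  finally show ?thesis .
qed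

lemma quad_form_decomposition:
  "quad_form I \<rho> h = of_real (\<Sum>k\<in>I. (cmod (\<Sum>i\<in>I. cnj (h i) * v k i))\<^sup>2)"
proof -
  have "quad_form I \<rho> h = (\<Sum>i\<in>I. \<Sum>j\<in>I. \<Sum>k\<in>I. (cnj (h i) * v k i) * cnj (cnj (h j) * v k j))"
    unfolding quad_form_def
    by (intro sum.cong) (auto simp: dec sum_distrib_left sum_distrib_right mult_ac)
  also have "\<dots> = (\<Sum>k\<in>I. \<Sum>i\<in>I. \<Sum>j\<in>I. (cnj (h i) * v k i) * cnj (cnj (h j) * v k j))"
    by (rule sum_rotate)
  also have "\<dots> = (\<Sum>k\<in>I. (\<Sum>i\<in>I. cnj (h i) * v k i) * cnj (\<Sum>i\<in>I. cnj (h i) * v k i))"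
    by (simp add: sum_product)
  also have "\<dots> = of_real (\<Sum>k\<in>I. (cmod (\<Sum>i\<in>I. cnj (h i) * v k i))\<^sup>2)"
    by (simp add: complex_norm_square del: of_real_power cnj_sum complex_cnj_mult)
  finally show ?thesis .
qed

lemma trace_frame_op:
  "trace_on I (op_mult I (frame_op I a) \<rho>) = of_real ((\<Sum>k\<in>I. overlap I (v k) a) / 8 ^ card I)"
proof -
  have "trace_on I (op_mult I (frame_op I a) \<rho>)
    = (\<Sum>x\<in>I. \<Sum>y\<in>I. \<Sum>k\<in>I. (cnj (v k x) * letter (a x)) * cnj (cnj (v k y) * letter (a y)) / 8 ^ card I)"
    unfolding trace_on_def op_mult_def frame_op_def
    by (intro sum.cong) (auto simp: dec sum_distrib_left sum_divide_distrib mult_ac)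
  also have "\<dots> = (\<Sum>k\<in>I. \<Sum>x\<in>I. \<Sum>y\<in>I. (cnj (v k x) * letter (a x)) * cnj (cnj (v k y) * letter (a y)) / 8 ^ card I)"
    by (rule sum_rotate)
  also have "\<dots> = (\<Sum>k\<in>I. amp I (\<lambda>i. cnj (v k i)) a * cnj (amp I (\<lambda>i. cnj (v k i)) a)) / 8 ^ card I"
    by (simp add: amp_def sum_product sum_divide_distrib)
  also have "\<dots> = of_real ((\<Sum>k\<in>I. overlap I (v k) a) / 8 ^ card I)"
    unfolding of_real_divide of_real_sum overlap_def complex_norm_square by simp
  finally show ?thesis .
qed

lemma frame_prob_decomposition: "frame_prob I \<rho> a = (\<Sum>k\<in>I. overlap I (v k) a) / 8 ^ card I"
  unfolding frame_prob_def trace_frame_op by (rule Re_complex_of_real)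

text \<open>Drawing an outcome weights a uniform word by its overlap with the state. A moment of
  \<open>g\<close> under the outcome law is therefore a letter moment of degree two higher.\<close>

lemma sum_frame_prob:
  "(\<Sum>a\<in>words I. frame_prob I \<rho> a * g a) = (\<Sum>k\<in>I. avg I (\<lambda>a. overlap I (v k) a * g a))"
proof -
  have "(\<Sum>a\<in>words I. frame_prob I \<rho> a * g a) = avg I (\<lambda>a. \<Sum>k\<in>I. overlap I (v k) a * g a)"
    by (simp add: avg_def frame_prob_decomposition divide_inverse sum_distrib_left sum_distrib_right mult_ac)
  then show ?thesis by (simp add: avg_sum)
qed

end

lemma sqn_cnj: "sqn I (\<lambda>i. cnj (c i)) = sqn I c"
  by (simp add: sqn_def)

context
  fixes I :: "'i set" and \<rho> :: "'i \<Rightarrow> 'i \<Rightarrow> complex"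
  assumes fin: "finite I" and \<rho>: "density_op I \<rho>"
begin

lemma density_decomposition:
  "\<exists>v. (\<forall>i\<in>I. \<forall>j\<in>I. \<rho> i j = (\<Sum>k\<in>I. v k i * cnj (v k j))) \<and> (\<Sum>k\<in>I. sqn I (v k)) = 1"
proof -
  obtain v where v: "\<forall>i\<in>I. \<forall>j\<in>I. \<rho> i j = (\<Sum>k\<in>I. v k i * cnj (v k j))"
    using psd_decomposition[OF fin] \<rho> unfolding density_op_def by blast
  have "complex_of_real (\<Sum>k\<in>I. sqn I (v k)) = of_real 1"
    using trace_decomposition[OF fin v] \<rho> by (simp add: density_op_def)
  then show ?thesis using v of_real_eq_iff by blast
qed

lemma frame_prob_nonneg: "frame_prob I \<rho> a \<ge> 0"
proof -
  obtain v where v: "\<forall>i\<in>I. \<forall>j\<in>I. \<rho> i j = (\<Sum>k\<in>I. v k i * cnj (v k j))"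
    "(\<Sum>k\<in>I. sqn I (v k)) = 1" using density_decomposition by blast
  show ?thesis
    unfolding frame_prob_decomposition[OF fin v(1)] by (auto simp: overlap_def intro!: sum_nonneg divide_nonneg_nonneg)
qed

lemma sum_frame_prob_one: "(\<Sum>a\<in>words I. frame_prob I \<rho> a) = 1"
proof -
  obtain v where v: "\<forall>i\<in>I. \<forall>j\<in>I. \<rho> i j = (\<Sum>k\<in>I. v k i * cnj (v k j))"
    "(\<Sum>k\<in>I. sqn I (v k)) = 1" using density_decomposition by blast
  show ?thesis using sum_frame_prob[OF fin v(1), where g = "\<lambda>_. 1"]
    by (simp add: overlap_def avg_amp_sq[OF fin] sqn_cnj v(2))
qed

text \<open>In the fourth moment formula the straight pairing contributes the trace 1 and the
  crossed pairing, summed over the components, the fidelity.\<close>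

lemma overlap_mean:
  assumes "pure_state I h"
  shows "(\<Sum>a\<in>words I. frame_prob I \<rho> a * overlap I h a) = 1 + fidelity I \<rho> h"
proof -
  obtain v where v: "\<forall>i\<in>I. \<forall>j\<in>I. \<rho> i j = (\<Sum>k\<in>I. v k i * cnj (v k j))"
    "(\<Sum>k\<in>I. sqn I (v k)) = 1" using density_decomposition by blast
  have h: "sqn I h = 1" using assms by (simp add: sqn_def pure_state_def)
  have "cmod (\<Sum>i\<in>I. cnj (v k i) * h i) = cmod (\<Sum>i\<in>I. cnj (h i) * v k i)" for k
    by (subst complex_mod_cnj[symmetric]) (simp add: mult.commute)
  then show ?thesis
    unfolding sum_frame_prob[OF fin v(1)] overlap_def avg_amp_fourth[OF fin] sqn_cnj h
      fidelity_def quad_form_decomposition[OF fin v(1)]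
    by (simp add: sum.distrib v(2) del: of_real_sum)
qed

text \<open>The mixed moment bound is linear in the weight of a component and the weights sum to the
  trace 1; no dimension enters.\<close>

lemma overlap_second_moment:
  assumes "pure_state I h"
  shows "(\<Sum>a\<in>words I. frame_prob I \<rho> a * (overlap I h a)\<^sup>2) \<le> 6"
proof -
  obtain v where v: "\<forall>i\<in>I. \<forall>j\<in>I. \<rho> i j = (\<Sum>k\<in>I. v k i * cnj (v k j))"
    "(\<Sum>k\<in>I. sqn I (v k)) = 1" using density_decomposition by blast
  have h: "sqn I (\<lambda>i. cnj (h i)) = 1" using assms by (simp add: sqn_def pure_state_def)
  have "(\<Sum>a\<in>words I. frame_prob I \<rho> a * (overlap I h a)\<^sup>2) \<le> (\<Sum>k\<in>I. 6 * sqn I (v k))"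
    unfolding sum_frame_prob[OF fin v(1)] overlap_def
    by (intro sum_mono order_trans[OF avg_amp_mixed_sixth[OF fin h]]) (simp add: sqn_cnj)
  then show ?thesis by (simp add: v(2) flip: sum_distrib_left)
qed

lemma frame_power_prob:
  "Re (trace_on (copies_basis N I) (op_mult (copies_basis N I) (frame_power I N g) (tensor_power N \<rho>)))
    = (\<Prod>k<N. frame_prob I \<rho> (g k))"
proof -
  obtain v where v: "\<forall>i\<in>I. \<forall>j\<in>I. \<rho> i j = (\<Sum>k\<in>I. v k i * cnj (v k j))"
    "(\<Sum>k\<in>I. sqn I (v k)) = 1" using density_decomposition by blast
  have "trace_on (copies_basis N I) (op_mult (copies_basis N I) (frame_power I N g) (tensor_power N \<rho>))
    = (\<Sum>x\<in>copies_basis N I. \<Sum>y\<in>copies_basis N I. \<Prod>k<N. frame_op I (g k) (x k) (y k) * \<rho> (y k) (x k))"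
    by (simp add: trace_on_def op_mult_def frame_power_def tensor_power_def prod.distrib)
  also have "\<dots> = (\<Sum>x\<in>copies_basis N I. \<Prod>k<N. \<Sum>y\<in>I. frame_op I (g k) (x k) y * \<rho> y (x k))"
    unfolding copies_basis_def
    by (intro sum.cong refl sum_prod_PiE) (use fin in auto)
  also have "\<dots> = (\<Prod>k<N. \<Sum>x\<in>I. \<Sum>y\<in>I. frame_op I (g k) x y * \<rho> y x)"
    unfolding copies_basis_def
    by (rule sum_prod_PiE[where f = "\<lambda>k x. \<Sum>y\<in>I. frame_op I (g k) x y * \<rho> y x"]) (use fin in auto)
  also have "\<dots> = (\<Prod>k<N. trace_on I (op_mult I (frame_op I (g k)) \<rho>))"
    by (simp add: trace_on_def op_mult_def)
  also have "\<dots> = of_real (\<Prod>k<N. frame_prob I \<rho> (g k))"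
    unfolding trace_frame_op[OF fin v(1)] frame_prob_decomposition[OF fin v(1)] by simp
  finally show ?thesis by (simp only: Re_complex_of_real)
qed

lemma prob_frame_power_compl:
  assumes "S \<subseteq> copies_basis N (words I)"
  shows "(\<Sum>g\<in>S. \<Prod>k<N. frame_prob I \<rho> (g k))
    = 1 - (\<Sum>g\<in>copies_basis N (words I) - S. \<Prod>k<N. frame_prob I \<rho> (g k))"
proof -
  have "(\<Sum>g\<in>copies_basis N (words I). \<Prod>k<N. frame_prob I \<rho> (g k)) = 1"
    using sum_prod_PiE[of "{..<N}" "words I" "\<lambda>_ a. frame_prob I \<rho> a"] fin
    by (simp add: copies_basis_def finite_words sum_frame_prob_one)
  moreover have "finite (copies_basis N (words I))"
    using fin by (simp add: copies_basis_def finite_words finite_PiE)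
  ultimately show ?thesis using sum.subset_diff[OF assms, of "\<lambda>g. \<Prod>k<N. frame_prob I \<rho> (g k)"] by simp
qed

text \<open>Truncating the overlap at \<open>36 / \<epsilon>\<close> makes it bounded, at the cost of a bias of at most
  \<open>6 / (36 / \<epsilon>)\<close> by the second moment bound.\<close>

definition clipped :: "real \<Rightarrow> ('i \<Rightarrow> complex) \<Rightarrow> ('i \<Rightarrow> nat) \<Rightarrow> real" where
  "clipped \<epsilon> h a = min (overlap I h a) (36 / \<epsilon>)"

definition clipped_mean :: "real \<Rightarrow> ('i \<Rightarrow> complex) \<Rightarrow> real" where
  "clipped_mean \<epsilon> h = (\<Sum>a\<in>words I. frame_prob I \<rho> a * clipped \<epsilon> h a)"

lemma clipped_mean_bounds:
  assumes "pure_state I h" "\<epsilon> > 0"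
  shows "clipped_mean \<epsilon> h \<le> 1 + fidelity I \<rho> h" "1 + fidelity I \<rho> h - \<epsilon> / 6 \<le> clipped_mean \<epsilon> h"
proof -
  show "clipped_mean \<epsilon> h \<le> 1 + fidelity I \<rho> h"
    unfolding overlap_mean[OF assms(1), symmetric] clipped_mean_def clipped_def
    by (intro sum_mono mult_left_mono frame_prob_nonneg) auto
  have "overlap I h a \<le> clipped \<epsilon> h a + \<epsilon> / 36 * (overlap I h a)\<^sup>2" for a
  proof (cases "overlap I h a \<le> 36 / \<epsilon>")
    case False
    then have "1 \<le> \<epsilon> / 36 * overlap I h a" using assms(2) by (simp add: field_simps)
    moreover have "overlap I h a \<ge> 0" by (simp add: overlap_def)
    ultimately have "1 * overlap I h a \<le> \<epsilon> / 36 * overlap I h a * overlap I h a"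
      by (intro mult_right_mono)
    moreover have "clipped \<epsilon> h a \<ge> 0" using assms(2) by (simp add: clipped_def overlap_def)
    ultimately show ?thesis by (simp add: power2_eq_square mult.assoc)
  qed (use assms(2) in \<open>simp add: clipped_def\<close>)
  then have "(\<Sum>a\<in>words I. frame_prob I \<rho> a * overlap I h a)
    \<le> (\<Sum>a\<in>words I. frame_prob I \<rho> a * (clipped \<epsilon> h a + \<epsilon> / 36 * (overlap I h a)\<^sup>2))"
    by (intro sum_mono mult_left_mono frame_prob_nonneg)
  also have "\<dots> = clipped_mean \<epsilon> h + \<epsilon> / 36 * (\<Sum>a\<in>words I. frame_prob I \<rho> a * (overlap I h a)\<^sup>2)"
    by (simp add: clipped_mean_def algebra_simps sum.distrib sum_distrib_left)
  also have "\<dots> \<le> clipped_mean \<epsilon> h + \<epsilon> / 36 * 6"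
    using overlap_second_moment[OF assms(1)] assms(2) by (intro add_left_mono mult_left_mono) auto
  finally show "1 + fidelity I \<rho> h - \<epsilon> / 6 \<le> clipped_mean \<epsilon> h"
    by (simp add: overlap_mean[OF assms(1)])
qed

lemma clipped_tail:
  assumes "pure_state I h" "\<epsilon> > 0" "\<sigma> \<in> {1, -1}"
  shows "(\<Sum>g\<in>{g\<in>copies_basis N (words I). \<sigma> * ((\<Sum>k<N. clipped \<epsilon> h (g k)) - real N * clipped_mean \<epsilon> h) \<ge> real N * (\<epsilon> / 6)}.
      \<Prod>k<N. frame_prob I \<rho> (g k)) \<le> exp (- (real N * (\<epsilon>\<^sup>2 / 864)))"
proof -
  \<comment> \<open>This choice minimises \<open>6 * s^2 - |s| * \<epsilon> / 6\<close>, the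
    exponent per copy for a deviation \<epsilon> / 6; the minimum is
    \<open>- \<epsilon>^2 / 864\<close>. The product of \<open>|s|\<close> with the cap
    \<open>36 / \<epsilon>\<close> is 1/2, within the range where the Chernoff bound
    applies.\<close>
  define s where "s = \<sigma> * \<epsilon> / 72"
  have \<sigma>: "\<bar>\<sigma>\<bar> = 1" "\<sigma>\<^sup>2 = 1" using assms(3) by auto
  have var: "(\<Sum>a\<in>words I. frame_prob I \<rho> a * (clipped \<epsilon> h a)\<^sup>2) \<le> 6"
  proof -
    have "(\<Sum>a\<in>words I. frame_prob I \<rho> a * (clipped \<epsilon> h a)\<^sup>2) \<le> (\<Sum>a\<in>words I. frame_prob I \<rho> a * (overlap I h a)\<^sup>2)"
      using assms(2) by (intro sum_mono mult_left_mono frame_prob_nonneg power_mono) (auto simp: clipped_def overlap_def)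
    then show ?thesis using overlap_second_moment[OF assms(1)] by linarith
  qed
  have *: "(\<Sum>g\<in>{g\<in>{..<N} \<rightarrow>\<^sub>E words I. s * (\<Sum>k<N. clipped \<epsilon> h (g k)) \<ge> real N * (s * clipped_mean \<epsilon> h + \<epsilon>\<^sup>2 / 432)}.
      \<Prod>k<N. frame_prob I \<rho> (g k)) \<le> exp (real N * (6 * s\<^sup>2 - \<epsilon>\<^sup>2 / 432))"
  proof (rule chernoff_finite[where B = "36 / \<epsilon>"])
    show "\<bar>s\<bar> * (36 / \<epsilon>) \<le> 1" using assms(2) \<sigma> by (simp add: s_def abs_mult)
  qed (use fin assms var in \<open>auto simp: finite_words frame_prob_nonneg sum_frame_prob_one clipped_mean_def clipped_def overlap_def\<close>)
  have "(s * (\<Sum>k<N. clipped \<epsilon> h (g k)) \<ge> real N * (s * clipped_mean \<epsilon> h + \<epsilon>\<^sup>2 / 432))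
    \<longleftrightarrow> (\<sigma> * ((\<Sum>k<N. clipped \<epsilon> h (g k)) - real N * clipped_mean \<epsilon> h) \<ge> real N * (\<epsilon> / 6))" for g
  proof -
    have "s * (\<Sum>k<N. clipped \<epsilon> h (g k)) - real N * (s * clipped_mean \<epsilon> h + \<epsilon>\<^sup>2 / 432)
      = \<epsilon> / 72 * (\<sigma> * ((\<Sum>k<N. clipped \<epsilon> h (g k)) - real N * clipped_mean \<epsilon> h) - real N * (\<epsilon> / 6))"
      by (simp add: s_def power2_eq_square algebra_simps)
    then show ?thesis using assms(2)
      by (smt (verit, best) zero_le_mult_iff divide_pos_pos)
  qed
  moreover have "6 * s\<^sup>2 - \<epsilon>\<^sup>2 / 432 = - (\<epsilon>\<^sup>2 / 864)"
    using \<sigma>(2) by (simp add: s_def power_mult_distrib power_divide)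
  ultimately show ?thesis using * by (simp add: copies_basis_def)
qed

end

text \<open>One record of outcomes estimates all hypotheses at once, and the maximiser of the
  empirical sum is returned. The loss \<epsilon> / 2 is one bias \<epsilon> / 6 and two deviations
  \<epsilon> / 6; the union bound runs over both tails of every hypothesis. Since
  \<open>good\<close> is quantified after the learner, it may depend on the unknown state.\<close>

lemma agnostic_selection:
  fixes I :: "'i set"
  assumes fin: "finite I" and H: "finite H" "H \<noteq> {}" "\<And>h. h \<in> H \<Longrightarrow> pure_state I h"
    and \<epsilon>: "\<epsilon> > 0" and \<delta>: "\<delta> > 0" and N: "real N \<ge> 864 * ln (2 * real (card H) / \<delta>) / \<epsilon>\<^sup>2"
  shows "\<exists>\<Omega> M out. learner I N \<Omega> M out \<and>
    (\<forall>\<rho> good. density_op I \<rho> \<longrightarrow>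
      (\<forall>\<psi>\<in>H. (\<forall>h\<in>H. fidelity I \<rho> \<psi> \<ge> fidelity I \<rho> h - \<epsilon> / 2) \<longrightarrow> good \<psi>) \<longrightarrow>
      success_prob I N \<Omega> M out \<rho> good \<ge> 1 - \<delta>)"
proof -
  define F where "F = copies_basis N (words I)"
  have finF: "finite F" using fin by (simp add: F_def copies_basis_def finite_words finite_PiE)
  \<comment> \<open>\<open>learner\<close> wants natural numbers as outcome labels, so the records
    of \<open>N\<close> words are enumerated.\<close>
  obtain e where e: "bij_betw e {..<card F} F"
    using finF by (metis atLeast0LessThan ex_bij_betw_nat_finite)
  define T where "T h g = (\<Sum>k<N. clipped I \<epsilon> h (g k))" for h g
  have "\<exists>h\<in>H. \<forall>h'\<in>H. T h' g \<le> T h g" for g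
  proof -
    have "Max ((\<lambda>h. T h g) ` H) \<in> (\<lambda>h. T h g) ` H" using H by (intro Max_in) auto
    then obtain h where "h \<in> H" "T h g = Max ((\<lambda>h. T h g) ` H)" by auto
    then show ?thesis using H(1) by (intro bexI[of _ h]) auto
  qed
  then obtain best where best: "\<And>g. best g \<in> H" "\<And>g h'. h' \<in> H \<Longrightarrow> T h' g \<le> T (best g) g"
    by metis
  define M where "M a = frame_power I N (e a)" for a
  define out where "out a = best (e a)" for a
  have povm: "povm (copies_basis N I) {..<card F} M"
    using povm_frame_power[OF fin, of N] sum.reindex_bij_betw[OF e, of "\<lambda>g. frame_power I N g x y" for x y]
      bij_betwE[OF e]
    by (auto simp: povm_def M_def F_def)
  have success: "success_prob I N {..<card F} M out \<rho> good \<ge> 1 - \<delta>"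
    if \<rho>: "density_op I \<rho>" and good: "\<And>\<psi>. \<psi> \<in> H \<Longrightarrow> \<forall>h\<in>H. fidelity I \<rho> \<psi> \<ge> fidelity I \<rho> h - \<epsilon> / 2 \<Longrightarrow> good \<psi>"
    for \<rho> good
  proof -
    define P where "P g = (\<Prod>k<N. frame_prob I \<rho> (g k))" for g
    have P0: "P g \<ge> 0" for g unfolding P_def by (intro prod_nonneg) (simp add: frame_prob_nonneg[OF fin \<rho>])
    define dev where "dev \<sigma> h = {g\<in>F. \<sigma> * (T h g - real N * clipped_mean I \<rho> \<epsilon> h) \<ge> real N * (\<epsilon> / 6)}" for \<sigma> h
    have dev: "sum P (dev \<sigma> h) \<le> exp (- (real N * (\<epsilon>\<^sup>2 / 864)))" if "h \<in> H" "\<sigma> \<in> {1,-1}" for \<sigma> h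
      using clipped_tail[OF fin \<rho> H(3)[OF that(1)] \<epsilon> that(2), of N] by (simp add: dev_def P_def F_def T_def)
    have "success_prob I N {..<card F} M out \<rho> good = (\<Sum>a\<in>{a\<in>{..<card F}. good (best (e a))}. P (e a))"
      by (simp add: success_prob_def outcome_prob_def M_def out_def P_def frame_power_prob[OF fin \<rho>])
    also have "\<dots> = sum P {g\<in>F. good (best g)}"
    proof (rule sum.reindex_bij_betw)
      show "bij_betw e {a \<in> {..<card F}. good (best (e a))} {g \<in> F. good (best g)}"
        using e by (auto simp: bij_betw_def inj_on_def)
    qed
    also have "\<dots> = 1 - sum P (F - {g\<in>F. good (best g)})"
      unfolding P_def F_def by (intro prob_frame_power_compl[OF fin \<rho>]) auto
    finally have eq: "success_prob I N {..<card F} M out \<rho> good = 1 - sum P (F - {g\<in>F. good (best g)})" .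
    have sub: "F - {g\<in>F. good (best g)} \<subseteq> (\<Union>(\<sigma>, h)\<in>{1,-1} \<times> H. dev \<sigma> h)"
    proof (rule subsetI, rule ccontr)
      fix g assume g: "g \<in> F - {g\<in>F. good (best g)}" and n: "g \<notin> (\<Union>(\<sigma>, h)\<in>{1,-1} \<times> H. dev \<sigma> h)"
      \<comment> \<open>Without copies both sides of the nonstrict inequality in \<open>dev\<close>
        are 0, so every record counts as a deviation.\<close>
      have N0: "real N > 0"
      proof (rule ccontr)
        assume "\<not> real N > 0"
        then have "g \<in> dev 1 (best g)" using g by (simp add: dev_def T_def)
        then show False using n best(1) by auto
      qed
      have close: "\<bar>T h g - real N * clipped_mean I \<rho> \<epsilon> h\<bar> < real N * (\<epsilon> / 6)" if "h \<in> H" for h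
      proof -
        have "g \<notin> dev 1 h" "g \<notin> dev (-1) h" using n that by auto
        then show ?thesis using g by (auto simp: dev_def abs_real_def)
      qed
      have "good (best g)"
      proof (rule good[OF best(1)], intro ballI)
        fix h assume h: "h \<in> H"
        have "real N * clipped_mean I \<rho> \<epsilon> h - real N * (\<epsilon> / 6) < real N * clipped_mean I \<rho> \<epsilon> (best g) + real N * (\<epsilon> / 6)"
          using close[OF h] close[OF best(1)[of g]] best(2)[OF h, of g] by linarith
        then have "real N * (clipped_mean I \<rho> \<epsilon> h - \<epsilon> / 6) < real N * (clipped_mean I \<rho> \<epsilon> (best g) + \<epsilon> / 6)"
          by (simp add: algebra_simps)
        then have "clipped_mean I \<rho> \<epsilon> h - \<epsilon> / 6 < clipped_mean I \<rho> \<epsilon> (best g) + \<epsilon> / 6"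
          using N0 by (simp only: mult_less_cancel_left_pos)
        then show "fidelity I \<rho> (best g) \<ge> fidelity I \<rho> h - \<epsilon> / 2"
          using clipped_mean_bounds[OF fin \<rho> H(3)[OF h] \<epsilon>] clipped_mean_bounds[OF fin \<rho> H(3)[OF best(1)[of g]] \<epsilon>]
          by linarith
      qed
      then show False using g by auto
    qed
    have cH: "real (card H) > 0" using H by (simp add: card_gt_0_iff)
    have "sum P (F - {g\<in>F. good (best g)}) \<le> sum P (\<Union>(\<sigma>, h)\<in>{1,-1} \<times> H. dev \<sigma> h)"
      using sub finF H(1) P0 by (intro sum_mono2) (auto simp: dev_def)
    also have "\<dots> \<le> (\<Sum>(\<sigma>, h)\<in>{1,-1} \<times> H. sum P (dev \<sigma> h))"
      using sum_UNION_le[of "{1,-1} \<times> H" "\<lambda>(\<sigma>, h). dev \<sigma> h" P] finF H(1) P0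
      by (simp add: case_prod_unfold dev_def)
    also have "\<dots> \<le> (\<Sum>x\<in>{1,-1::real} \<times> H. exp (- (real N * (\<epsilon>\<^sup>2 / 864))))"
    proof (intro sum_mono)
      fix x :: "real \<times> ('i \<Rightarrow> complex)" assume "x \<in> {1,-1} \<times> H"
      then show "(case x of (\<sigma>, h) \<Rightarrow> sum P (dev \<sigma> h)) \<le> exp (- (real N * (\<epsilon>\<^sup>2 / 864)))"
        using dev[of "snd x" "fst x"] by (simp add: case_prod_unfold mem_Times_iff)
    qed
    also have "\<dots> = 2 * real (card H) * exp (- (real N * (\<epsilon>\<^sup>2 / 864)))"
      by (simp add: card_cartesian_product)
    also have "\<dots> \<le> 2 * real (card H) * exp (- ln (2 * real (card H) / \<delta>))"
    proof -
      have "ln (2 * real (card H) / \<delta>) \<le> real N * (\<epsilon>\<^sup>2 / 864)"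
        using N \<epsilon> by (simp add: field_simps)
      then show ?thesis using cH by simp
    qed
    also have "\<dots> = \<delta>" using cH \<delta> by (simp add: exp_minus)
    finally show ?thesis using eq by linarith
  qed
  have learner: "learner I N {..<card F} M out"
    using povm best(1) H(3) by (simp add: learner_def out_def)
  show ?thesis
    by (intro exI[of _ "{..<card F}"] exI[of _ M] exI[of _ out] conjI allI impI learner success) auto
qed

section \<open>Covering tree tensor networks\<close>

text \<open>Newton interpolation with greedy pivots. A function of the span is normalised to 1 at
  the point \<open>x0\<close> where its modulus is largest, so it is bounded by 1; subtracting its
  multiple with the same value at \<open>x0\<close> costs one generator. The new coefficient is at
  most 1 plus the old sum, whence the recursion
  \<open>2 * (2 ^ m - 1) + 1 = 2 ^ (m + 1) - 1\<close>. Nodes and coefficients serve all \<alpha>,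
  which later depend on the indices of the rest of the tree.\<close>

lemma bounded_interpolation:
  fixes g :: "'j \<Rightarrow> 'x \<Rightarrow> complex"
  assumes "finite X" "X \<noteq> {}" "finite J" "card J \<le> m"
  shows "\<exists>\<kappa> c. (\<forall>k<m. \<kappa> k \<in> X) \<and> (\<forall>x\<in>X. (\<Sum>k<m. cmod (c k x)) \<le> 2 ^ m - 1) \<and>
    (\<forall>\<alpha>. \<forall>x\<in>X. (\<Sum>j\<in>J. \<alpha> j * g j x) = (\<Sum>k<m. c k x * (\<Sum>j\<in>J. \<alpha> j * g j (\<kappa> k))))"
  using assms(3,4)
proof (induction m arbitrary: J g)
  case 0
  then show ?case by auto
next
  case (Suc m)
  show ?case
  proof (cases "\<forall>\<alpha>. \<forall>x\<in>X. (\<Sum>j\<in>J. \<alpha> j * g j x) = 0")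
    case True
    obtain x1 where "x1 \<in> X" using assms(2) by auto
    then show ?thesis using True one_le_power[of "2::real" "Suc m"] by (intro exI[of _ "\<lambda>_. x1"] exI[of _ "\<lambda>_ _. 0"]) auto
  next
    case False
    then obtain \<alpha>1 x1 where x1: "x1 \<in> X" "(\<Sum>j\<in>J. \<alpha>1 j * g j x1) \<noteq> 0" by blast
    define f1 where "f1 x = (\<Sum>j\<in>J. \<alpha>1 j * g j x)" for x
    have "Max ((\<lambda>x. cmod (f1 x)) ` X) \<in> (\<lambda>x. cmod (f1 x)) ` X"
      using assms(1,2) by (intro Max_in) auto
    then obtain x0 where x0: "x0 \<in> X" "cmod (f1 x0) = Max ((\<lambda>x. cmod (f1 x)) ` X)" by auto
    have max: "cmod (f1 x) \<le> cmod (f1 x0)" if "x \<in> X" for x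
      using assms(1) that by (simp add: x0(2))
    have nz: "f1 x0 \<noteq> 0" using max[OF x1(1)] x1(2) by (auto simp: f1_def)
    define \<alpha>0 where "\<alpha>0 j = \<alpha>1 j / f1 x0" for j
    define f0 where "f0 x = (\<Sum>j\<in>J. \<alpha>0 j * g j x)" for x
    have f0: "f0 x = f1 x / f1 x0" for x
      by (simp add: f0_def f1_def \<alpha>0_def sum_divide_distrib)
    have f0_bound: "cmod (f0 x) \<le> 1" if "x \<in> X" for x
      using max[OF that] nz by (simp add: f0 norm_divide)
    have f0_x0: "f0 x0 = 1" using nz by (simp add: f0)
    have "\<exists>i\<in>J. \<alpha>0 i \<noteq> 0"
    proof (rule ccontr)
      assume "\<not> (\<exists>i\<in>J. \<alpha>0 i \<noteq> 0)"
      then have "f0 x0 = 0" by (simp add: f0_def)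
      then show False using f0_x0 by simp
    qed
    then obtain i where i: "i \<in> J" "\<alpha>0 i \<noteq> 0" by blast
    define g' where "g' j x = g j x - g j x0 * f0 x" for j x
    have "finite (J - {i})" "card (J - {i}) \<le> m" using Suc.prems i by auto
    then obtain \<kappa>' c' where IH: "\<forall>k<m. \<kappa>' k \<in> X" "\<forall>x\<in>X. (\<Sum>k<m. cmod (c' k x)) \<le> 2 ^ m - 1"
      "\<forall>\<alpha>. \<forall>x\<in>X. (\<Sum>j\<in>J-{i}. \<alpha> j * g' j x) = (\<Sum>k<m. c' k x * (\<Sum>j\<in>J-{i}. \<alpha> j * g' j (\<kappa>' k)))"
      using Suc.IH[of "J - {i}" g'] by blast
    define \<kappa> where "\<kappa> = \<kappa>'(m := x0)"
    define c where "c k x = (if k = m then f0 x - (\<Sum>k<m. c' k x * f0 (\<kappa>' k)) else c' k x)" for k x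
    have "(\<Sum>k<Suc m. cmod (c k x)) \<le> 2 ^ Suc m - 1" if "x \<in> X" for x
    proof -
      have "cmod (\<Sum>k<m. c' k x * f0 (\<kappa>' k)) \<le> (\<Sum>k<m. cmod (c' k x))"
        using IH(1) f0_bound by (intro order_trans[OF norm_sum] sum_mono) (auto simp: norm_mult intro!: mult_left_le)
      then have "cmod (c m x) \<le> 1 + (\<Sum>k<m. cmod (c' k x))"
        using f0_bound[OF that] norm_triangle_ineq4[of "f0 x" "\<Sum>k<m. c' k x * f0 (\<kappa>' k)"] by (simp add: c_def)
      moreover have "(\<Sum>k<m. cmod (c k x)) = (\<Sum>k<m. cmod (c' k x))" by (simp add: c_def)
      ultimately show ?thesis using IH(2) that by fastforce
    qed
    moreover have "(\<Sum>j\<in>J. \<alpha> j * g j x) = (\<Sum>k<Suc m. c k x * (\<Sum>j\<in>J. \<alpha> j * g j (\<kappa> k)))" if "x \<in> X" for \<alpha> x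
    proof -
      \<comment> \<open>Passing from \<open>F\<close> to \<open>F - F x0 * f0\<close> annihilates
        multiples of \<open>f0\<close>, so \<alpha> may be shifted along \<open>\<alpha>0\<close>
        until the coefficient of generator \<open>i\<close> is 0.\<close>
      define t where "t = \<alpha> i / \<alpha>0 i"
      define \<beta> where "\<beta> j = \<alpha> j - t * \<alpha>0 j" for j
      define F where "F x = (\<Sum>j\<in>J. \<alpha> j * g j x)" for x
      have \<beta>i: "\<beta> i = 0" using i by (simp add: \<beta>_def t_def)
      have "(\<Sum>j\<in>J-{i}. \<beta> j * g j x) = (\<Sum>j\<in>J. \<beta> j * g j x)" for x
        using sum.remove[OF Suc.prems(1) i(1), of "\<lambda>j. \<beta> j * g j x"] \<beta>i by simp
      also have "\<dots> x = F x - t * f0 x" for x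
        by (simp add: \<beta>_def F_def f0_def algebra_simps sum_subtractf sum_distrib_left)
      finally have \<beta>: "(\<Sum>j\<in>J-{i}. \<beta> j * g j x) = F x - t * f0 x" for x .
      have G: "(\<Sum>j\<in>J-{i}. \<beta> j * g' j x) = F x - F x0 * f0 x" for x
      proof -
        have "(\<Sum>j\<in>J-{i}. \<beta> j * g' j x) = (\<Sum>j\<in>J-{i}. \<beta> j * g j x) - (\<Sum>j\<in>J-{i}. \<beta> j * g j x0) * f0 x"
          by (simp add: g'_def algebra_simps sum_subtractf sum_distrib_left sum_distrib_right)
        then show ?thesis unfolding \<beta> by (simp add: f0_x0 algebra_simps)
      qed
      have "F x - F x0 * f0 x = (\<Sum>k<m. c' k x * (F (\<kappa>' k) - F x0 * f0 (\<kappa>' k)))"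
        using IH(3)[rule_format, OF that, of \<beta>] unfolding G .
      then have "F x = (\<Sum>k<m. c' k x * F (\<kappa>' k)) + c m x * F x0"
        by (simp add: c_def algebra_simps sum_subtractf sum_distrib_left)
      moreover have "(\<Sum>k<m. c k x * F (\<kappa> k)) = (\<Sum>k<m. c' k x * F (\<kappa>' k))"
        by (intro sum.cong) (auto simp: c_def \<kappa>_def)
      ultimately show ?thesis by (simp add: F_def \<kappa>_def)
    qed
    moreover have "\<forall>k<Suc m. \<kappa> k \<in> X" using IH(1) x0 by (auto simp: \<kappa>_def less_Suc_eq)
    ultimately show ?thesis by blast
  qed
qed

text \<open>Trees are grown leaf by leaf from the root; the construction read backwards is the order
  in which leaves are eliminated.\<close>

inductive rooted :: "nat \<Rightarrow> nat set \<Rightarrow> nat set set \<Rightarrow> bool" for r where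
  root: "rooted r {r} {}"
| leaf: "rooted r V E \<Longrightarrow> u \<in> V \<Longrightarrow> v \<notin> V \<Longrightarrow> rooted r (insert v V) (insert {u, v} E)"

lemma rooted_finite: "rooted r V E \<Longrightarrow> finite V \<and> finite E \<and> (\<forall>e\<in>E. e \<subseteq> V)"
  by (induction rule: rooted.induct) auto

definition net_value ::
  "nat set \<Rightarrow> nat set set \<Rightarrow> (nat set \<Rightarrow> nat) \<Rightarrow> (nat \<Rightarrow> nat \<Rightarrow> (nat set \<Rightarrow> nat) \<Rightarrow> complex) \<Rightarrow> (nat \<Rightarrow> nat) \<Rightarrow> complex" where
  "net_value V E w \<phi> i = (\<Sum>j \<in> (\<Pi>\<^sub>E e\<in>E. {..<w e}). \<Prod>v\<in>V. \<phi> v (i v) (restrict j (incident E v)))"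

text \<open>A relaxation of tree states that survives leaf elimination: alphabets vary with the
  vertex, and normalisation is weakened to a bound on each amplitude, which restricting an index to
  interpolation nodes preserves.\<close>

definition bounded_nets :: "nat set \<Rightarrow> nat set set \<Rightarrow> (nat \<Rightarrow> nat set) \<Rightarrow> nat \<Rightarrow> ((nat \<Rightarrow> nat) \<Rightarrow> complex) set" where
  "bounded_nets V E X \<chi> = {\<psi>. \<exists>w \<phi>. (\<forall>e\<in>E. w e \<le> \<chi>) \<and>
     (\<forall>i\<in>PiE V X. \<psi> i = net_value V E w \<phi> i \<and> cmod (\<psi> i) \<le> 1)}"

text \<open>The edge to the leaf is contracted last. As a function of \<open>i v\<close> the value
  is then a combination of \<open>w {u, v}\<close> fixed functions, with coefficients depending on
  the other indices: the form in which interpolation applies.\<close>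

lemma net_value_leaf:
  assumes fin: "finite V" "finite E" and sub: "\<And>e. e \<in> E \<Longrightarrow> e \<subseteq> V" and u: "u \<in> V" and v: "v \<notin> V"
  shows "net_value (insert v V) (insert {u, v} E) w \<phi> i =
    (\<Sum>l<w {u, v}. (\<Sum>j\<in>(\<Pi>\<^sub>E e\<in>E. {..<w e}). (\<Prod>x\<in>V-{u}. \<phi> x (i x) (restrict j (incident E x))) *
        \<phi> u (i u) ((restrict j (incident E u))({u, v} := l))) * \<phi> v (i v) (\<lambda>e\<in>{{u, v}}. l))"
proof -
  define e0 where "e0 = {u, v}"
  have e0: "e0 \<notin> E" using sub[of e0] v by (auto simp: e0_def)
  let ?E = "insert e0 E"
  have iv: "incident ?E v = {e0}" using sub v by (auto simp: incident_def e0_def)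
  have iu: "incident ?E u = insert e0 (incident E u)" by (auto simp: incident_def e0_def)
  have ix: "incident ?E x = incident E x" "e0 \<notin> incident E x" if "x \<in> V - {u}" for x
    using that v e0 by (auto simp: incident_def e0_def)
  have step: "(\<Prod>x\<in>insert v V. \<phi> x (i x) (restrict (j(e0 := l)) (incident ?E x))) =
      ((\<Prod>x\<in>V-{u}. \<phi> x (i x) (restrict j (incident E x))) *
        \<phi> u (i u) ((restrict j (incident E u))(e0 := l))) * \<phi> v (i v) (\<lambda>e\<in>{e0}. l)" for l j
  proof -
    have 1: "restrict (j(e0 := l)) (incident ?E v) = (\<lambda>e\<in>{e0}. l)" by (auto simp: iv)
    have 2: "restrict (j(e0 := l)) (incident ?E u) = (restrict j (incident E u))(e0 := l)"
      by (auto simp: iu fun_eq_iff)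
    have 3: "restrict (j(e0 := l)) (incident ?E x) = restrict j (incident E x)" if "x \<in> V - {u}" for x
      using ix[OF that] by (auto simp: fun_eq_iff restrict_def)
    have "(\<Prod>x\<in>insert v V. \<phi> x (i x) (restrict (j(e0 := l)) (incident ?E x))) =
      \<phi> v (i v) (restrict (j(e0 := l)) (incident ?E v)) * (\<phi> u (i u) (restrict (j(e0 := l)) (incident ?E u)) *
        (\<Prod>x\<in>V-{u}. \<phi> x (i x) (restrict (j(e0 := l)) (incident ?E x))))"
      using fin u v by (simp add: prod.remove[of V u])
    also have "(\<Prod>x\<in>V-{u}. \<phi> x (i x) (restrict (j(e0 := l)) (incident ?E x)))
       = (\<Prod>x\<in>V-{u}. \<phi> x (i x) (restrict j (incident E x)))"
      by (intro prod.cong) (auto simp only: 3)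
    finally show ?thesis
      by (simp only: 1 2 mult_ac)
  qed
  have "net_value (insert v V) ?E w \<phi> i = (\<Sum>(l, j)\<in>{..<w e0} \<times> (\<Pi>\<^sub>E e\<in>E. {..<w e}).
      \<Prod>x\<in>insert v V. \<phi> x (i x) (restrict (j(e0 := l)) (incident ?E x)))"
    unfolding net_value_def PiE_insert_eq
    using inj_combinator[OF e0, of "\<lambda>e. {..<w e}"]
    by (subst sum.reindex) (auto simp: case_prod_unfold)
  also have "\<dots> = (\<Sum>(l, j)\<in>{..<w e0} \<times> (\<Pi>\<^sub>E e\<in>E. {..<w e}).
      ((\<Prod>x\<in>V-{u}. \<phi> x (i x) (restrict j (incident E x))) *
        \<phi> u (i u) ((restrict j (incident E u))(e0 := l))) * \<phi> v (i v) (\<lambda>e\<in>{e0}. l))"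
    unfolding step ..
  also have "\<dots> = (\<Sum>l<w e0. (\<Sum>j\<in>(\<Pi>\<^sub>E e\<in>E. {..<w e}). (\<Prod>x\<in>V-{u}. \<phi> x (i x) (restrict j (incident E x))) *
        \<phi> u (i u) ((restrict j (incident E u))(e0 := l))) * \<phi> v (i v) (\<lambda>e\<in>{e0}. l))"
    by (simp add: sum.cartesian_product[symmetric] sum_distrib_right)
  finally show ?thesis by (simp add: e0_def)
qed

lemma degree_leaf:
  assumes "finite E" "\<And>e. e \<in> E \<Longrightarrow> e \<subseteq> V" "u \<in> V" "v \<notin> V"
  shows "degree (insert {u, v} E) u = Suc (degree E u)"
    "x \<in> V \<Longrightarrow> x \<noteq> u \<Longrightarrow> degree (insert {u, v} E) x = degree E x"
proof -
  have "{u, v} \<notin> E" using assms by blast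
  moreover have "incident (insert {u, v} E) u = insert {u, v} (incident E u)" by (auto simp: incident_def)
  ultimately show "degree (insert {u, v} E) u = Suc (degree E u)"
    using assms(1) by (simp add: degree_def) (simp add: incident_def)
  assume "x \<in> V" "x \<noteq> u"
  then have "incident (insert {u, v} E) x = incident E x" using assms by (auto simp: incident_def)
  then show "degree (insert {u, v} E) x = degree E x" by (simp add: degree_def)
qed

lemma approximate_by_grid:
  fixes f :: "'a \<Rightarrow> complex"
  assumes "\<And>z. cmod z \<le> R \<Longrightarrow> \<exists>y\<in>G. cmod (z - y) \<le> \<eta>" "\<And>x. x \<in> A \<Longrightarrow> cmod (f x) \<le> R"
  shows "\<exists>y\<in>A \<rightarrow>\<^sub>E G. \<forall>x\<in>A. cmod (f x - y x) \<le> \<eta>"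
proof -
  have "\<forall>x\<in>A. \<exists>y. y \<in> G \<and> cmod (f x - y) \<le> \<eta>" using assms by blast
  then obtain y where "\<forall>x\<in>A. y x \<in> G \<and> cmod (f x - y x) \<le> \<eta>" by metis
  then show ?thesis by (intro bexI[of _ "restrict y A"]) auto
qed

text \<open>A leaf \<open>v\<close> attached to \<open>u\<close> is removed by interpolating \<open>\<psi>\<close> in the index \<open>i v\<close> from at most
  \<open>\<chi>\<close> values of \<open>i v\<close>; the interpolation nodes become part of the physical index of \<open>u\<close>. This
  avoids any bound on the tensors, which may involve large cancellations.\<close>

lemma covering_bounded_nets:
  assumes "rooted r V E" and \<chi>: "\<chi> \<ge> 1" and \<eta>: "\<eta> > 0"
    and G: "finite G" "\<And>z. cmod z \<le> 2 ^ \<chi> \<Longrightarrow> \<exists>y\<in>G. cmod (z - y) \<le> \<eta>"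
    and "\<And>v. v \<in> V \<Longrightarrow> finite (X v) \<and> X v \<noteq> {} \<and> card (X v) * \<chi> ^ degree E v \<le> B"
    and "\<eta> * (2 ^ (\<chi> + 2)) ^ card V \<le> 1"
  shows "\<exists>F. finite F \<and> card F \<le> card G ^ (\<chi> * B * card V) \<and>
    (\<forall>\<psi>\<in>bounded_nets V E X \<chi>. \<exists>f\<in>F. \<forall>i\<in>PiE V X. cmod (\<psi> i - f i) \<le> \<eta> * (2 ^ (\<chi> + 2)) ^ card V)"
  using assms(1,6,7)
proof (induction arbitrary: X rule: rooted.induct)
  have cG: "card G \<ge> 1"
  proof -
    have "G \<noteq> {}" using G(2)[of 0] by auto
    then show ?thesis using G(1) by (simp add: Suc_le_eq card_gt_0_iff)
  qed
  case root
  have X: "finite (X r)" "card (X r) \<le> B" using root.prems(1)[of r] by (auto simp: degree_def incident_def)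
  define F where "F = (\<lambda>y (i :: nat \<Rightarrow> nat). y (i r) :: complex) ` (X r \<rightarrow>\<^sub>E G)"
  have "card F \<le> card (X r \<rightarrow>\<^sub>E G)" unfolding F_def by (intro card_image_le finite_PiE X G)
  also have "\<dots> = card G ^ card (X r)" using X by (simp add: card_PiE)
  also have "\<dots> \<le> card G ^ (\<chi> * B * card {r})" using X \<chi> cG by (intro power_increasing) (auto intro: order_trans[of _ B])
  finally have "card F \<le> card G ^ (\<chi> * B * card {r})" .
  moreover have "\<exists>f\<in>F. \<forall>i\<in>PiE {r} X. cmod (\<psi> i - f i) \<le> \<eta> * (2 ^ (\<chi> + 2)) ^ card {r}"
    if "\<psi> \<in> bounded_nets {r} {} X \<chi>" for \<psi>
  proof -
    have "cmod (\<psi> (\<lambda>y\<in>{r}. x)) \<le> 2 ^ \<chi>" if "x \<in> X r" for x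
    proof -
      have "(\<lambda>y\<in>{r}. x) \<in> PiE {r} X" using that by auto
      then have "cmod (\<psi> (\<lambda>y\<in>{r}. x)) \<le> 1" using \<open>\<psi> \<in> _\<close> unfolding bounded_nets_def by blast
      also have "1 \<le> (2::real) ^ \<chi>" by simp
      finally show ?thesis .
    qed
    then obtain y where y: "y \<in> X r \<rightarrow>\<^sub>E G" "\<forall>x\<in>X r. cmod (\<psi> (\<lambda>z\<in>{r}. x) - y x) \<le> \<eta>"
      using approximate_by_grid[where R = "2 ^ \<chi>" and G = G and \<eta> = \<eta> and A = "X r" and f = "\<lambda>x. \<psi> (\<lambda>z\<in>{r}. x)"] G(2) by blast
    have "cmod (\<psi> i - y (i r)) \<le> \<eta> * (2 ^ (\<chi> + 2)) ^ card {r}" if i: "i \<in> PiE {r} X" for i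
    proof -
      have "(\<lambda>z\<in>{r}. i r) = i" using i by (auto simp: fun_eq_iff PiE_def extensional_def)
      then have "cmod (\<psi> i - y (i r)) \<le> \<eta>" using y(2) i by (metis PiE_mem singletonI)
      also have "\<dots> \<le> \<eta> * (2 ^ (\<chi> + 2)) ^ card {r}"
        using \<eta> mult_left_mono[OF one_le_power[of "2::real" "\<chi> + 2"], of \<eta>] by simp
      finally show ?thesis .
    qed
    then show ?thesis using y(1) by (auto simp: F_def)
  qed
  moreover have "finite F" using X G by (simp add: F_def finite_PiE)
  ultimately show ?case by blast
next
  case (leaf V E u v X)
  define e0 where "e0 = {u, v}"
  define K :: real where "K = 2 ^ (\<chi> + 2)"
  \<comment> \<open>The index of \<open>u\<close> now also records which interpolation node replaces
    \<open>i v\<close>. The alphabet grows by the factor \<chi> while the degree of \<open>u\<close>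
    drops by one, so the bound \<open>B\<close> on alphabet size times
    \<open>\<chi> ^ degree\<close> persists.\<close>
  define X' where "X' = X(u := prod_encode ` (X u \<times> {..<\<chi>}))"
  define \<eta>' where "\<eta>' = \<eta> * K ^ card V"
  have fin: "finite V" "finite E" "\<And>e. e \<in> E \<Longrightarrow> e \<subseteq> V" using rooted_finite[OF leaf.hyps(1)] by auto
  have K1: "K \<ge> 1" unfolding K_def by (rule one_le_power) simp
  have cV: "card (insert v V) = Suc (card V)" using fin leaf.hyps by simp
  have \<eta>'1: "\<eta> \<le> \<eta>'" "\<eta>' \<le> 1"
  proof -
    have "1 \<le> K ^ card V" using K1 by simp
    then show "\<eta> \<le> \<eta>'" using \<eta> by (simp add: \<eta>'_def)
    then have "\<eta>' * 1 \<le> \<eta>' * K" using K1 \<eta> by (intro mult_left_mono) auto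
    also have "\<dots> \<le> 1" using leaf.prems(2) unfolding cV by (simp add: \<eta>'_def K_def mult_ac)
    finally show "\<eta>' \<le> 1" by simp
  qed
  have X: "finite (X x)" "X x \<noteq> {}" if "x \<in> insert v V" for x using leaf.prems(1)[OF that] by auto
  have X': "finite (X' x) \<and> X' x \<noteq> {} \<and> card (X' x) * \<chi> ^ degree E x \<le> B" if x: "x \<in> V" for x
  proof (cases "x = u")
    case True
    have "card (X' u) = card (X u) * \<chi>"
      by (simp add: X'_def card_image card_cartesian_product inj_prod_encode[THEN inj_on_subset[OF _ subset_UNIV]])
    then show ?thesis using True x leaf.prems(1)[of u] \<chi> degree_leaf(1)[OF fin(2,3) leaf.hyps(2,3)]
      by (auto simp: X'_def mult_ac)
  next
    case False
    then show ?thesis using x leaf.prems(1)[of x] degree_leaf(2)[OF fin(2,3) leaf.hyps(2,3) x False]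
      by (auto simp: X'_def)
  qed
  obtain F' where F': "finite F'" "card F' \<le> card G ^ (\<chi> * B * card V)"
    "\<And>\<psi>. \<psi> \<in> bounded_nets V E X' \<chi> \<Longrightarrow> \<exists>f\<in>F'. \<forall>i\<in>PiE V X'. cmod (\<psi> i - f i) \<le> \<eta>'"
    using leaf.IH[OF X'] \<eta>'1(2) unfolding \<eta>'_def K_def by blast
  define enc where "enc i k = (restrict i V)(u := prod_encode (i u, k))" for i :: "nat \<Rightarrow> nat" and k
  define A where "A = {..<\<chi>} \<times> X v"
  \<comment> \<open>An element of \<open>F\<close> is rebuilt from a table \<open>y\<close> of
    approximate coefficients and approximate node amplitudes \<open>f\<close>. The nodes are not
    tabulated: they are absorbed in the amplitudes on the smaller tree.\<close>
  define F where "F = (\<lambda>(f, y) i. \<Sum>k<\<chi>. y (k, i v) * f (enc i k)) ` (F' \<times> (A \<rightarrow>\<^sub>E G))"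
  have finA: "finite A" using X by (simp add: A_def)
  have finF: "finite F" using F'(1) finA G(1) by (simp add: F_def finite_PiE)
  have cG: "card G \<ge> 1"
  proof -
    have "G \<noteq> {}" using G(2)[of 0] by auto
    then show ?thesis using G(1) by (simp add: Suc_le_eq card_gt_0_iff)
  qed
  have "card F \<le> card (F' \<times> (A \<rightarrow>\<^sub>E G))"
    unfolding F_def using F'(1) finA G(1) by (intro card_image_le) (simp add: finite_PiE)
  also have "\<dots> = card F' * card G ^ card A" using finA by (simp add: card_cartesian_product card_PiE)
  also have "\<dots> \<le> card G ^ (\<chi> * B * card V) * card G ^ (\<chi> * B)"
  proof (intro mult_mono F' power_increasing cG)
    have "card (X v) * 1 \<le> card (X v) * \<chi> ^ degree (insert {u, v} E) v"
      using \<chi> by (intro mult_left_mono) auto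
    also have "\<dots> \<le> B" using leaf.prems(1)[of v] by blast
    finally have "card (X v) \<le> B" by simp
    then show "card A \<le> \<chi> * B" by (simp add: A_def card_cartesian_product)
  qed auto
  also have "\<dots> = card G ^ (\<chi> * B * card (insert v V))" unfolding cV by (simp add: power_add mult_ac)
  finally have cF: "card F \<le> card G ^ (\<chi> * B * card (insert v V))" .
  have "\<exists>f\<in>F. \<forall>i\<in>PiE (insert v V) X. cmod (\<psi> i - f i) \<le> \<eta> * K ^ card (insert v V)"
    if \<psi>: "\<psi> \<in> bounded_nets (insert v V) (insert e0 E) X \<chi>" for \<psi>
  proof -
    obtain w \<phi> where w: "\<forall>e\<in>insert e0 E. w e \<le> \<chi>"
      and \<phi>: "\<And>i. i \<in> PiE (insert v V) X \<Longrightarrow> \<psi> i = net_value (insert v V) (insert e0 E) w \<phi> i"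
      and \<psi>1: "\<And>i. i \<in> PiE (insert v V) X \<Longrightarrow> cmod (\<psi> i) \<le> 1"
      using \<psi> unfolding bounded_nets_def by blast
    define g where "g l x = \<phi> v x (\<lambda>e\<in>{e0}. l)" for l x
    define \<alpha> where "\<alpha> i l = (\<Sum>j\<in>(\<Pi>\<^sub>E e\<in>E. {..<w e}). (\<Prod>x\<in>V-{u}. \<phi> x (i x) (restrict j (incident E x))) *
        \<phi> u (i u) ((restrict j (incident E u))(e0 := l)))" for i l
    have val: "net_value (insert v V) (insert e0 E) w \<phi> i = (\<Sum>l<w e0. \<alpha> i l * g l (i v))" for i
      using net_value_leaf[of V E u v w \<phi> i, OF fin(1,2) _ leaf.hyps(2,3)] fin(3)
      by (simp add: \<alpha>_def g_def e0_def)
    obtain \<kappa> c where \<kappa>: "\<forall>k<\<chi>. \<kappa> k \<in> X v" and c: "\<forall>x\<in>X v. (\<Sum>k<\<chi>. cmod (c k x)) \<le> 2 ^ \<chi> - 1"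
      and interp: "\<forall>\<alpha>. \<forall>x\<in>X v. (\<Sum>l\<in>{..<w e0}. \<alpha> l * g l x) = (\<Sum>k<\<chi>. c k x * (\<Sum>l\<in>{..<w e0}. \<alpha> l * g l (\<kappa> k)))"
      using bounded_interpolation[of "X v" "{..<w e0}" \<chi> g] X[of v] w by auto
    \<comment> \<open>An index of the smaller tree names an index of the larger one in which
      \<open>v\<close> sits at an interpolation node.\<close>
    define dec where "dec i = i(u := fst (prod_decode (i u)), v := \<kappa> (snd (prod_decode (i u))))" for i
    define \<psi>' where "\<psi>' i = \<psi> (dec i)" for i
    have dec_enc: "dec (enc i k) = i(v := \<kappa> k)" if "i \<in> PiE (insert v V) X" for i k
      using that leaf.hyps by (auto simp: dec_def enc_def fun_eq_iff PiE_def extensional_def)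
    have dec_mem: "dec i \<in> PiE (insert v V) X" if i: "i \<in> PiE V X'" for i
    proof -
      have "i u \<in> X' u" using i leaf.hyps by auto
      then obtain a k where ak: "i u = prod_encode (a, k)" "a \<in> X u" "k < \<chi>" by (auto simp: X'_def)
      have "i x \<in> X x" if "x \<in> V" "x \<noteq> u" for x using i that by (auto simp: X'_def PiE_def Pi_def)
      then show ?thesis using i ak \<kappa> leaf.hyps by (auto simp: dec_def PiE_def extensional_def)
    qed
    have "\<psi>' \<in> bounded_nets V E X' \<chi>"
    proof -
      \<comment> \<open>The leaf tensor, evaluated at the node, is contracted into the tensor of
        \<open>u\<close>; the other tensors and the remaining bonds are unchanged.\<close>
      define \<phi>' where "\<phi>' x = (if x = u then (\<lambda>y j. \<Sum>l<w e0. \<phi> u (fst (prod_decode y)) (j(e0 := l)) *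
          g l (\<kappa> (snd (prod_decode y)))) else \<phi> x)" for x
      have "\<psi>' i = net_value V E w \<phi>' i" if i: "i \<in> PiE V X'" for i
      proof -
        have dv: "dec i v = \<kappa> (snd (prod_decode (i u)))" "dec i u = fst (prod_decode (i u))"
          "\<And>x. x \<in> V - {u} \<Longrightarrow> dec i x = i x"
          using leaf.hyps by (auto simp: dec_def)
        have "\<psi>' i = (\<Sum>l<w e0. \<alpha> (dec i) l * g l (dec i v))"
          using \<phi>[OF dec_mem[OF i]] by (simp add: \<psi>'_def val)
        also have "\<dots> = (\<Sum>j\<in>(\<Pi>\<^sub>E e\<in>E. {..<w e}). \<Sum>l<w e0. (\<Prod>x\<in>V-{u}. \<phi> x (dec i x) (restrict j (incident E x))) *
            \<phi> u (dec i u) ((restrict j (incident E u))(e0 := l)) * g l (dec i v))"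
          unfolding \<alpha>_def sum_distrib_right by (rule sum.swap)
        also have "\<dots> = (\<Sum>j\<in>(\<Pi>\<^sub>E e\<in>E. {..<w e}). (\<Prod>x\<in>V-{u}. \<phi> x (dec i x) (restrict j (incident E x))) *
            \<phi>' u (i u) (restrict j (incident E u)))"
          by (simp add: \<phi>'_def dv sum_distrib_left mult.assoc)
        also have "\<dots> = (\<Sum>j\<in>(\<Pi>\<^sub>E e\<in>E. {..<w e}). (\<Prod>x\<in>V-{u}. \<phi>' x (i x) (restrict j (incident E x))) *
            \<phi>' u (i u) (restrict j (incident E u)))"
          by (intro sum.cong refl arg_cong2[where f = "(*)"] prod.cong) (auto simp: dv(3) \<phi>'_def)
        also have "\<dots> = net_value V E w \<phi>' i"
          unfolding net_value_def
          by (intro sum.cong refl) (simp add: prod.remove[OF fin(1) leaf.hyps(2)] mult.commute)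
        finally show ?thesis .
      qed
      moreover have "cmod (\<psi>' i) \<le> 1" if "i \<in> PiE V X'" for i
        using \<psi>1[OF dec_mem[OF that]] by (simp add: \<psi>'_def)
      ultimately show ?thesis unfolding bounded_nets_def using w by blast
    qed
    then obtain f where f: "f \<in> F'" "\<forall>i\<in>PiE V X'. cmod (\<psi>' i - f i) \<le> \<eta>'"
      using F'(3) by blast
    have c1: "cmod (c k x) \<le> 2 ^ \<chi>" if "k < \<chi>" "x \<in> X v" for k x
    proof -
      have "cmod (c k x) \<le> (\<Sum>k<\<chi>. cmod (c k x))" using that by (intro member_le_sum) auto
      then show ?thesis using c that by fastforce
    qed
    then obtain y where y: "y \<in> A \<rightarrow>\<^sub>E G" "\<forall>p\<in>A. cmod ((case p of (k, x) \<Rightarrow> c k x) - y p) \<le> \<eta>"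
      using approximate_by_grid[where R = "2 ^ \<chi>" and G = G and \<eta> = \<eta> and A = A and f = "\<lambda>(k, x). c k x"] G(2)
      by (auto simp: A_def)
    have err: "cmod (\<psi> i - (\<Sum>k<\<chi>. y (k, i v) * f (enc i k))) \<le> \<eta> * K ^ card (insert v V)"
      if i: "i \<in> PiE (insert v V) X" for i
    proof -
      have iv: "i v \<in> X v" using i by auto
      have enc_mem: "enc i k \<in> PiE V X'" if "k < \<chi>" for k
        using i that leaf.hyps by (auto simp: enc_def X'_def PiE_def Pi_def extensional_def)
      have upd: "i(v := \<kappa> k) \<in> PiE (insert v V) X" if "k < \<chi>" for k
        using i that \<kappa> by (auto simp: PiE_def extensional_def Pi_def)
      \<comment> \<open>The coefficients \<alpha> ignore the leaf index, so the inner sums of the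
        interpolation formula are amplitudes of \<psi> with \<open>v\<close> at the nodes.\<close>
      have \<alpha>_upd: "\<alpha> (i(v := x)) = \<alpha> i" for x
      proof
        fix l
        have "u \<noteq> v" using leaf.hyps by auto
        moreover have "(\<Prod>x'\<in>V-{u}. \<phi> x' ((i(v := x)) x') (restrict j (incident E x')))
          = (\<Prod>x'\<in>V-{u}. \<phi> x' (i x') (restrict j (incident E x')))" for j
          using leaf.hyps by (intro prod.cong) auto
        ultimately show "\<alpha> (i(v := x)) l = \<alpha> i l" by (simp only: \<alpha>_def fun_upd_other not_False_eq_True simp_thms)
      qed
      have "\<psi> i = (\<Sum>k<\<chi>. c k (i v) * (\<Sum>l<w e0. \<alpha> i l * g l (\<kappa> k)))"
        using \<phi>[OF i] interp iv by (simp add: val)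
      also have "\<dots> = (\<Sum>k<\<chi>. c k (i v) * \<psi>' (enc i k))"
        using \<phi>[OF upd] by (intro sum.cong) (auto simp: \<psi>'_def dec_enc[OF i] val \<alpha>_upd)
      finally have split: "\<psi> i - (\<Sum>k<\<chi>. y (k, i v) * f (enc i k))
        = (\<Sum>k<\<chi>. c k (i v) * (\<psi>' (enc i k) - f (enc i k)) + (c k (i v) - y (k, i v)) * f (enc i k))"
        by (simp add: algebra_simps sum_subtractf sum.distrib)
      have "cmod (\<psi> i - (\<Sum>k<\<chi>. y (k, i v) * f (enc i k))) \<le> (\<Sum>k<\<chi>. cmod (c k (i v)) * \<eta>' + \<eta> * 2)"
        unfolding split
      proof (intro order_trans[OF norm_sum] sum_mono order_trans[OF norm_triangle_ineq] add_mono)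
        fix k assume k: "k \<in> {..<\<chi>}"
        have d: "cmod (\<psi>' (enc i k) - f (enc i k)) \<le> \<eta>'" using f(2) enc_mem k by auto
        then show "cmod (c k (i v) * (\<psi>' (enc i k) - f (enc i k))) \<le> cmod (c k (i v)) * \<eta>'"
          by (simp add: norm_mult mult_left_mono)
        have "cmod (\<psi>' (enc i k)) \<le> 1" using \<psi>1[OF upd] k by (simp add: \<psi>'_def dec_enc[OF i])
        \<comment> \<open>An accumulated error of at most 1 keeps the approximants bounded by 2, so
          a coefficient error \<eta> costs at most \<open>2 * \<eta>\<close>.\<close>
        then have "cmod (f (enc i k)) \<le> 2"
          using d \<eta>'1(2) norm_triangle_ineq2[of "f (enc i k)" "\<psi>' (enc i k)"] by (simp add: norm_minus_commute)
        moreover have "cmod (c k (i v) - y (k, i v)) \<le> \<eta>" using y(2) k iv by (auto simp: A_def)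
        ultimately show "cmod ((c k (i v) - y (k, i v)) * f (enc i k)) \<le> \<eta> * 2"
          unfolding norm_mult using \<eta> by (intro mult_mono) auto
      qed
      also have "\<dots> = (\<Sum>k<\<chi>. cmod (c k (i v))) * \<eta>' + real \<chi> * (\<eta> * 2)"
        by (simp only: sum.distrib sum_distrib_right sum_constant card_lessThan)
      \<comment> \<open>Uses \<open>real \<chi> \<le> 2 ^ \<chi>\<close>. The total factor
        \<open>3 * 2 ^ \<chi>\<close> explains the growth by \<open>K = 4 * 2 ^ \<chi>\<close> per
        leaf.\<close>
      also have "\<dots> \<le> 2 ^ \<chi> * \<eta>' + 2 ^ \<chi> * (\<eta>' * 2)"
      proof (intro add_mono mult_mono)
        have "(\<Sum>k<\<chi>. cmod (c k (i v))) \<le> 2 ^ \<chi> - 1" using c iv by blast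
        then show "(\<Sum>k<\<chi>. cmod (c k (i v))) \<le> 2 ^ \<chi>" by linarith
      qed (use \<eta>'1 \<eta> in \<open>auto simp: less_imp_le of_nat_less_two_power\<close>)
      also have "\<dots> \<le> K * \<eta>'" using \<eta>'1 \<eta> by (simp add: K_def power_add)
      also have "\<dots> = \<eta> * K ^ card (insert v V)" unfolding cV by (simp add: \<eta>'_def mult_ac)
      finally show ?thesis .
    qed
    have mem: "(\<lambda>i. \<Sum>k<\<chi>. y (k, i v) * f (enc i k)) \<in> F"
      unfolding F_def using f(1) y(1) by (intro image_eqI[where x = "(f, y)"]) auto
    show ?thesis by (intro bexI[OF _ mem] ballI err)
  qed
  then show ?case unfolding K_def e0_def by (intro exI[of _ F] conjI ballI finF cF)
qed

section \<open>Rooted trees\<close>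

lemma is_path_append:
  "is_path E (p @ q) \<Longrightarrow> p \<noteq> [] \<Longrightarrow> is_path E p"
  "is_path E (p @ q) \<Longrightarrow> q \<noteq> [] \<Longrightarrow> is_path E q"
  by (auto simp: is_path_def successively_append_iff)

lemma is_path_mono: "is_path E p \<Longrightarrow> E \<subseteq> E' \<Longrightarrow> is_path E' p"
  by (auto simp: is_path_def elim: successively_mono)

lemma is_path_snoc:
  "is_path E (p @ [u]) \<longleftrightarrow> (p = [] \<or> is_path E p \<and> u \<notin> set p \<and> {last p, u} \<in> E)"
  by (auto simp: is_path_def successively_append_iff)

lemma is_path_Cons:
  "is_path E (u # p) \<longleftrightarrow> (p = [] \<or> is_path E p \<and> u \<notin> set p \<and> {u, hd p} \<in> E)"
  by (auto simp: is_path_def successively_Cons)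

lemma is_path_rev: "is_path E (rev p) \<longleftrightarrow> is_path E p"
  by (simp add: is_path_def insert_commute)

lemma rooted_connected:
  assumes "rooted r V E" "x \<in> V" "y \<in> V"
  shows "\<exists>p. is_path E p \<and> set p \<subseteq> V \<and> hd p = x \<and> last p = y"
  using assms
proof (induction arbitrary: x y rule: rooted.induct)
  case root
  then show ?case by (intro exI[of _ "[r]"]) (auto simp: is_path_def)
next
  case (leaf V E u v)
  have ext: "\<exists>p. is_path (insert {u, v} E) p \<and> set p \<subseteq> insert v V \<and> hd p = x \<and> last p = v" if x: "x \<in> V" for x
  proof -
    obtain p where p: "is_path E p" "set p \<subseteq> V" "hd p = x" "last p = u" using leaf.IH[OF x leaf.hyps(2)] by blast
    have "is_path (insert {u, v} E) (p @ [v])"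
      using p leaf.hyps is_path_mono[OF p(1), of "insert {u, v} E"] by (auto simp: is_path_snoc)
    then show ?thesis using p by (intro exI[of _ "p @ [v]"]) (auto simp: is_path_def)
  qed
  show ?case
  proof (cases "x = v")
    case xv: True
    show ?thesis
    proof (cases "y = v")
      case True
      then show ?thesis using xv by (intro exI[of _ "[v]"]) (auto simp: is_path_def)
    next
      case False
      then obtain p where p: "is_path (insert {u, v} E) p" "set p \<subseteq> insert v V" "hd p = y" "last p = v"
        using ext[of y] leaf.prems by auto
      then show ?thesis using xv
        by (intro exI[of _ "rev p"]) (auto simp: is_path_rev hd_rev last_rev)
    qed
  next
    case xv: False
    show ?thesis
    proof (cases "y = v")
      case True
      then show ?thesis using ext[of x] xv leaf.prems by auto
    next
      case False
      then obtain p where p: "is_path E p" "set p \<subseteq> V" "hd p = x" "last p = y"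
        using leaf.IH[of x y] leaf.prems xv by auto
      then show ?thesis using is_path_mono[OF p(1), of "insert {u, v} E"] by blast
    qed
  qed
qed

lemma path_leaves_set:
  assumes "is_path E p" "hd p \<in> S" "last p \<notin> S"
  shows "\<exists>u\<in>S. \<exists>v. v \<notin> S \<and> v \<in> set p \<and> {u, v} \<in> E"
  using assms
proof (induction p)
  case (Cons a p)
  show ?case
  proof (cases "p = []")
    case False
    then have p: "is_path E p" "{a, hd p} \<in> E" "hd p \<in> set p" "last p \<notin> S" "a \<in> S"
      using Cons.prems by (auto simp: is_path_Cons)
    show ?thesis
    proof (cases "hd p \<in> S")
      case True
      then show ?thesis using Cons.IH[OF p(1) _ p(4)] by auto
    next
      case False
      then show ?thesis using p by (intro bexI[of _ a] exI[of _ "hd p"]) auto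
    qed
  qed (use Cons in auto)
qed (simp add: is_path_def)

context
  fixes V E
  assumes tree: "is_tree V E"
begin

lemma tree_finite: "finite V" and tree_edge: "e \<in> E \<Longrightarrow> e \<subseteq> V \<and> card e = 2"
  and tree_connected: "u \<in> V \<Longrightarrow> v \<in> V \<Longrightarrow> \<exists>p. is_path E p \<and> hd p = u \<and> last p = v"
  and tree_acyclic: "is_path E c \<Longrightarrow> 3 \<le> length c \<Longrightarrow> {last c, hd c} \<notin> E"
  using tree by (auto simp: is_tree_def simple_graph_def is_cycle_def)

text \<open>Take a largest vertex set \<open>W\<close> whose induced edges form a rooted tree.
  Connectedness yields an edge from \<open>W\<close> to some \<open>v\<close> outside, and
  acyclicity makes it the only one between \<open>W\<close> and \<open>v\<close>, so
  \<open>W\<close> can grow unless it is everything.\<close>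

lemma tree_rooted:
  assumes "r \<in> V"
  shows "rooted r V E"
proof -
  define P where "P V' \<longleftrightarrow> V' \<subseteq> V \<and> rooted r V' {e\<in>E. e \<subseteq> V'}" for V'
  have no_loop: "{e\<in>E. e \<subseteq> {r}} = {}"
  proof -
    have False if "e \<in> E" "e \<subseteq> {r}" for e
      using tree_edge[OF that(1)] card_mono[OF _ that(2)] by simp
    then show ?thesis by blast
  qed
  have "P {r}" unfolding P_def no_loop using assms by (simp add: rooted.root)
  moreover have "finite {V'. P V'}" using tree_finite by (auto simp: P_def intro: finite_subset[of _ "Pow V"])
  ultimately obtain W where W: "P W" and max: "\<And>W'. P W' \<Longrightarrow> card W' \<le> card W"
  proof -
    have "Max (card ` {V'. P V'}) \<in> card ` {V'. P V'}"
      using \<open>P {r}\<close> \<open>finite {V'. P V'}\<close> by (intro Max_in) auto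
    then obtain W where "P W" "card W = Max (card ` {V'. P V'})" by auto
    then show ?thesis using that \<open>finite {V'. P V'}\<close> by auto
  qed
  have WV: "W \<subseteq> V" "finite W" and rW: "rooted r W {e\<in>E. e \<subseteq> W}" using W tree_finite by (auto simp: P_def finite_subset)
  have "r \<in> W" using rW by (induction rule: rooted.induct) auto
  show ?thesis
  proof (cases "W = V")
    case True
    then have "{e\<in>E. e \<subseteq> W} = E" using tree_edge by auto
    then show ?thesis using rW True by simp
  next
    case False
    then obtain x where x: "x \<in> V" "x \<notin> W" using WV by blast
    obtain p where p: "is_path E p" "hd p = r" "last p = x" using tree_connected[OF assms x(1)] by blast
    obtain u v where uv: "u \<in> W" "v \<notin> W" "{u, v} \<in> E"
      using path_leaves_set[OF p(1), of W] p x \<open>r \<in> W\<close> by blast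
    have "{e\<in>E. e \<subseteq> insert v W} = insert {u, v} {e\<in>E. e \<subseteq> W}"
    proof (intro equalityI subsetI)
      fix e assume e: "e \<in> {e\<in>E. e \<subseteq> insert v W}"
      show "e \<in> insert {u, v} {e\<in>E. e \<subseteq> W}"
      proof (cases "v \<in> e")
        case True
        then obtain u' where u': "e = {u', v}" "u' \<noteq> v"
          using e tree_edge[of e] by (auto simp: card_2_iff)
        then have u'W: "u' \<in> W" using e by auto
        have "u' = u"
        proof (rule ccontr)
          \<comment> \<open>Two edges from \<open>W\<close> to \<open>v\<close> would close a cycle
            with a path inside \<open>W\<close>.\<close>
          assume ne: "u' \<noteq> u"
          obtain q where q: "is_path {e\<in>E. e \<subseteq> W} q" "set q \<subseteq> W" "hd q = u" "last q = u'"
            using rooted_connected[OF rW uv(1) u'W] by blast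
          have "is_path E (q @ [v])"
            using is_path_mono[OF q(1), of E] q uv u' e by (auto simp: is_path_snoc)
          moreover have "3 \<le> length (q @ [v])"
            using q ne by (cases q rule: rev_cases; cases "butlast q") (auto simp: is_path_def)
          ultimately have "{last (q @ [v]), hd (q @ [v])} \<notin> E" by (rule tree_acyclic)
          moreover have "hd (q @ [v]) = u" using q by (auto simp: is_path_def)
          ultimately show False using uv(3) by (simp add: insert_commute)
        qed
        then show ?thesis using u' by auto
      qed (use e in auto)
    qed (use uv in auto)
    then have "P (insert v W)" using rooted.leaf[OF rW uv(1,2)] WV uv tree_edge[OF uv(3)] by (auto simp: P_def)
    then show ?thesis using max[of "insert v W"] WV uv by simp
  qed
qed

section \<open>Neighbours, children and degrees\<close>

definition nbrs :: "nat \<Rightarrow> nat set" where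
  "nbrs v = {u. {v, u} \<in> E}"

lemma nbrs_subset: "nbrs v \<subseteq> V - {v}"
proof
  fix u assume "u \<in> nbrs v"
  then show "u \<in> V - {v}" using tree_edge[of "{v, u}"] by (cases "u = v") (auto simp: nbrs_def)
qed

lemma finite_nbrs: "finite (nbrs v)"
  using nbrs_subset tree_finite by (meson finite_Diff finite_subset)

lemma card_nbrs: "card (nbrs v) = degree E v"
proof -
  have "bij_betw (\<lambda>u. {v, u}) (nbrs v) (incident E v)"
    unfolding bij_betw_def
  proof
    show "inj_on (\<lambda>u. {v, u}) (nbrs v)" by (auto simp: inj_on_def doubleton_eq_iff)
    show "(\<lambda>u. {v, u}) ` nbrs v = incident E v"
    proof (intro equalityI subsetI)
      fix e assume e: "e \<in> incident E v"
      then obtain u where "e = {v, u}" using tree_edge[of e] by (auto simp: incident_def card_2_iff)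
      then show "e \<in> (\<lambda>u. {v, u}) ` nbrs v" using e by (auto simp: nbrs_def incident_def)
    qed (auto simp: nbrs_def incident_def)
  qed
  then show ?thesis by (simp add: degree_def bij_betw_same_card)
qed

lemma children_subset: "children E r v \<subseteq> nbrs v"
  by (auto simp: children_def nbrs_def is_path_def successively_append_iff)

lemma card_children_le_degree: "card (children E r v) \<le> degree E v"
  unfolding card_nbrs[symmetric] by (intro card_mono finite_nbrs children_subset)

lemma children_root: "children E r r = nbrs r"
proof (intro equalityI children_subset subsetI)
  fix u assume u: "u \<in> nbrs r"
  then have "is_path E ([] @ [r, u])" using nbrs_subset[of r] by (auto simp: is_path_def nbrs_def)
  then show "u \<in> children E r r" unfolding children_def by (intro CollectI exI[of _ "[]"]) simp
qed

text \<open>The exceptional neighbour \<open>w\<close> precedes \<open>v\<close> on a path from the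
  root. Any other neighbour either prolongs this path or lies on it and closes a cycle. If
  \<open>w\<close> were a child too, there would be a path from the root to \<open>v\<close>
  avoiding \<open>w\<close> and one to \<open>w\<close> avoiding \<open>v\<close>, which together
  with the edge between \<open>v\<close> and \<open>w\<close> contain a cycle.\<close>

lemma children_nonroot:
  assumes "r \<in> V" "v \<in> V" "v \<noteq> r"
  shows "\<exists>w\<in>nbrs v. children E r v = nbrs v - {w}"
proof -
  obtain p where p: "is_path E p" "hd p = r" "last p = v" using tree_connected assms by blast
  have "p \<noteq> []" using p by (simp add: is_path_def)
  then obtain p1 where p1: "p = p1 @ [v]" using p(3) by (metis append_butlast_last_id)
  have "p1 \<noteq> []" using p1 p(2) assms(3) by auto
  then obtain p2 w where p2: "p1 = p2 @ [w]" by (metis append_butlast_last_id)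
  have path: "is_path E (p2 @ [w, v])" "hd (p2 @ [w, v]) = r" using p p1 p2 by auto
  have path': "is_path E ((p2 @ [w]) @ [v])" using path by simp
  have w: "w \<in> nbrs v" using path by (auto simp: nbrs_def is_path_def successively_append_iff insert_commute)
  have "u \<in> children E r v" if u: "u \<in> nbrs v" "u \<noteq> w" for u
  proof (cases "u \<in> set (p2 @ [w, v])")
    case False
    then have "is_path E (((p2 @ [w]) @ [v]) @ [u])"
      using path' u unfolding is_path_snoc[of E "(p2 @ [w]) @ [v]"] by (auto simp: nbrs_def)
    moreover have "hd ((p2 @ [w]) @ [v, u]) = r" using path(2) by (cases p2) auto
    ultimately show ?thesis unfolding children_def by (auto intro!: exI[of _ "p2 @ [w]"])
  next
    case True
    moreover have "u \<noteq> v" using nbrs_subset[of v] u by auto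
    ultimately have "u \<in> set p2" using u by auto
    then obtain a c where ac: "p2 = a @ u # c" by (auto simp: in_set_conv_decomp)
    have "is_path E (u # c @ [w, v])" using is_path_append(2)[of E a] path(1) ac by simp
    then have "{last (u # c @ [w, v]), hd (u # c @ [w, v])} \<notin> E" by (rule tree_acyclic) simp
    then show ?thesis using u by (simp add: nbrs_def)
  qed
  moreover have "w \<notin> children E r v"
  proof
    assume "w \<in> children E r v"
    then obtain q where q: "is_path E (q @ [v, w])" "hd (q @ [v, w]) = r" by (auto simp: children_def)
    have q': "is_path E ((q @ [v]) @ [w])" using q by simp
    define A where "A = q @ [v]"
    define B where "B = p2 @ [w]"
    have A: "is_path E A" "w \<notin> set A" "hd A = r" "last A = v"
      using q' q(2) unfolding is_path_snoc[of E "q @ [v]"] by (cases q; auto simp: A_def)+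
    have B: "is_path E B" "v \<notin> set B" "hd B = r" "last B = w"
      using path' path(2) unfolding is_path_snoc[of E "p2 @ [w]"] by (cases p2; auto simp: B_def)+
    have "r \<in> set A" "r \<in> set B" using A B by (metis hd_in_set is_path_def)+
    \<comment> \<open>Beyond the last vertex \<open>z\<close> of \<open>B\<close> on
      \<open>A\<close>, the path \<open>B\<close> stays off \<open>A\<close>; hence going from
      \<open>v\<close> back along \<open>A\<close> to \<open>z\<close> and on along \<open>B\<close>
      to \<open>w\<close> is a path.\<close>
    then obtain b1 z b2 where b: "B = b1 @ z # b2" "z \<in> set A" "\<forall>y\<in>set b2. y \<notin> set A"
      using split_list_last_prop[of B "\<lambda>y. y \<in> set A"] by blast
    obtain a1 a2 where a: "A = a1 @ z # a2" using b(2) by (auto simp: in_set_conv_decomp)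
    have "b2 \<noteq> []" using b A(2) B(4) by auto
    have "a2 \<noteq> []" using a b B(2) A(4) by auto
    have zb: "is_path E (z # b2)" using is_path_append(2)[of E b1 "z # b2"] B b by simp
    have za: "is_path E (z # a2)" using is_path_append(2)[of E a1 "z # a2"] A a by simp
    have za': "is_path E (rev a2 @ [z])" using za is_path_rev[of E "z # a2"] by simp
    have "is_path E ((rev a2 @ [z]) @ b2)"
      using za' zb b(3) a \<open>b2 \<noteq> []\<close>
      by (auto simp: is_path_def successively_append_iff successively_Cons)
    moreover have "3 \<le> length ((rev a2 @ [z]) @ b2)" using \<open>a2 \<noteq> []\<close> \<open>b2 \<noteq> []\<close>
      by (cases a2; cases b2) auto
    ultimately have "{last ((rev a2 @ [z]) @ b2), hd ((rev a2 @ [z]) @ b2)} \<notin> E" by (rule tree_acyclic)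
    moreover have "last ((rev a2 @ [z]) @ b2) = w" using B(4) b \<open>b2 \<noteq> []\<close> by simp
    moreover have "hd ((rev a2 @ [z]) @ b2) = v" using A(4) a \<open>a2 \<noteq> []\<close> by (simp add: hd_append hd_rev)
    ultimately show False using w by (simp add: nbrs_def insert_commute)
  qed
  ultimately show ?thesis using w children_subset[of r v] by blast
qed

lemma card_children_nonroot:
  assumes "r \<in> V" "v \<in> V" "v \<noteq> r"
  shows "Suc (card (children E r v)) = degree E v"
proof -
  obtain w where w: "w \<in> nbrs v" "children E r v = nbrs v - {w}" using children_nonroot[OF assms] by blast
  have "card (nbrs v) > 0" using w finite_nbrs by (auto simp: card_gt_0_iff)
  then show ?thesis using w finite_nbrs[of v] by (simp add: card_nbrs[symmetric])
qed

lemma card_children_le: "v \<in> V \<Longrightarrow> card (children E r v) \<le> max_children V E r"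
  unfolding max_children_def using tree_finite by (intro Max_ge) auto

lemma degree_le_max_degree: "v \<in> V \<Longrightarrow> degree E v \<le> max_degree V E"
  unfolding max_degree_def using tree_finite by (intro Max_ge) auto

text \<open>A vertex other than the root has one neighbour more than children. If there is such a
  vertex, the leaf root has exactly one child, so \<open>max_children\<close> is at least 1 and
  doubling it absorbs the parent.\<close>

lemma degree_le_twice_max_children:
  assumes r: "leaf_root V E r" and v: "v \<in> V"
  shows "degree E v \<le> 2 * max_children V E r"
proof (cases "v = r")
  case True
  then show ?thesis using card_children_le[OF v, of r] children_root[of r] card_nbrs[of r] by simp
next
  case False
  have rV: "r \<in> V" using r by (simp add: leaf_root_def)
  have "card V \<ge> 2" using card_mono[OF tree_finite, of "{r, v}"] rV v False by simp
  then have "degree E r = 1" using r by (simp add: leaf_root_def)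
  then have "max_children V E r \<ge> 1" using card_children_le[OF rV, of r] children_root[of r] card_nbrs[of r] by simp
  then show ?thesis using card_children_le[OF v, of r] card_children_nonroot[OF rV v False] by simp
qed

text \<open>Away from the root the parent accounts for the missing unit. The root has one child, so
  a maximum degree of at least 2 is required; a third vertex forces it at the neighbour of the
  root.\<close>

lemma max_children_le:
  assumes r: "leaf_root V E r" and n: "card V \<ge> 3"
  shows "max_children V E r \<le> max_degree V E - 1"
proof -
  have rV: "r \<in> V" and dr: "degree E r = 1" using r n by (auto simp: leaf_root_def)
  obtain s where s: "nbrs r = {s}" using dr card_nbrs[of r] by (metis card_1_singletonE)
  have "\<exists>t\<in>V. t \<noteq> r \<and> t \<noteq> s"
  proof (rule ccontr)
    assume "\<not> (\<exists>t\<in>V. t \<noteq> r \<and> t \<noteq> s)"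
    then have "V \<subseteq> {r, s}" by auto
    then have "card V \<le> card {r, s}" by (intro card_mono) auto
    also have "\<dots> \<le> 2" by (simp add: card_insert_if)
    finally show False using n by simp
  qed
  then obtain t where t: "t \<in> V" "t \<noteq> r" "t \<noteq> s" by blast
  obtain p where p: "is_path E p" "hd p = r" "last p = t" using tree_connected[OF rV t(1)] by blast
  then obtain x q where q: "p = r # x # q" using t by (cases p; cases "tl p") (auto simp: is_path_def)
  have "x \<in> nbrs r" using p q by (auto simp: is_path_def nbrs_def)
  then have x: "x = s" using s by simp
  then obtain y q' where q': "q = y # q'" using p q t by (cases q) auto
  have "{r, y} \<subseteq> nbrs s" "r \<noteq> y" using p q q' x by (auto simp: is_path_def nbrs_def insert_commute)
  then have "degree E s \<ge> 2" using card_mono[OF finite_nbrs, of "{r, y}" s] by (simp add: card_nbrs)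
  moreover have sV: "s \<in> V" using nbrs_subset[of r] s by auto
  ultimately have \<Delta>: "max_degree V E \<ge> 2" using degree_le_max_degree[OF sV] by simp
  have "card (children E r v) \<le> max_degree V E - 1" if v: "v \<in> V" for v
  proof (cases "v = r")
    case True
    then show ?thesis using card_children_le_degree[of r r] dr \<Delta> by simp
  next
    case False
    then show ?thesis using card_children_nonroot[OF rV v False] degree_le_max_degree[OF v] by simp
  qed
  then show ?thesis unfolding max_children_def using tree_finite rV by (subst Max_le_iff) auto
qed

end

section \<open>Learning tree tensor network states\<close>

text \<open>With spacing \<eta> / 2, rounding down costs at most \<eta> / 2 in each coordinate.
  There are \<open>2 * m + 1\<close> values per coordinate, and
  \<open>2 * m + 1 \<le> 4 * R / \<eta> + 3 \<le> 7 * R / \<eta>\<close>.\<close>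

lemma grid_exists:
  fixes R \<eta> :: real
  assumes "0 < \<eta>" "\<eta> \<le> R"
  shows "\<exists>G. finite G \<and> real (card G) \<le> (7 * R / \<eta>)\<^sup>2 \<and> (\<forall>z. cmod z \<le> R \<longrightarrow> (\<exists>y\<in>G. cmod (z - y) \<le> \<eta>))"
proof -
  define m where "m = \<lceil>2 * R / \<eta>\<rceil>"
  define pt where "pt = (\<lambda>(a :: int, b :: int). Complex (\<eta> / 2 * a) (\<eta> / 2 * b))"
  define G where "G = pt ` ({-m..m} \<times> {-m..m})"
  have m: "2 * R / \<eta> \<le> m" "m < 2 * R / \<eta> + 1" unfolding m_def by linarith+
  have R: "1 \<le> R / \<eta>" using assms by simp
  have "card G \<le> card ({-m..m} \<times> {-m..m})" unfolding G_def by (intro card_image_le) simp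
  also have "\<dots> = (nat (2 * m + 1))\<^sup>2" by (simp add: card_cartesian_product power2_eq_square)
  finally have "real (card G) \<le> (real (nat (2 * m + 1)))\<^sup>2" by (simp flip: of_nat_power)
  also have "\<dots> \<le> (7 * R / \<eta>)\<^sup>2"
    using m R by (intro power_mono) auto
  finally have "real (card G) \<le> (7 * R / \<eta>)\<^sup>2" .
  moreover have "\<exists>y\<in>G. cmod (z - y) \<le> \<eta>" if z: "cmod z \<le> R" for z
  proof -
    have coord: "\<lfloor>x * 2 / \<eta>\<rfloor> \<in> {-m..m} \<and> \<bar>x - \<eta> / 2 * \<lfloor>x * 2 / \<eta>\<rfloor>\<bar> \<le> \<eta> / 2" if x: "\<bar>x\<bar> \<le> R" for x
    proof -
      have "\<bar>x\<bar> * 2 / \<eta> \<le> R * 2 / \<eta>" using x assms by (intro divide_right_mono) auto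
      then have "\<bar>x * 2 / \<eta>\<bar> \<le> m" using m(1) assms by (simp add: abs_mult mult.commute)
      then have "\<lfloor>x * 2 / \<eta>\<rfloor> \<in> {-m..m}" by (simp add: le_floor_iff floor_le_iff abs_le_iff del: abs_divide abs_mult)
      moreover have "\<bar>x - \<eta> / 2 * \<lfloor>x * 2 / \<eta>\<rfloor>\<bar> \<le> \<eta> / 2"
      proof -
        have "\<bar>x * 2 / \<eta> - \<lfloor>x * 2 / \<eta>\<rfloor>\<bar> \<le> 1" by linarith
        then have "\<eta> / 2 * \<bar>x * 2 / \<eta> - \<lfloor>x * 2 / \<eta>\<rfloor>\<bar> \<le> \<eta> / 2 * 1" using assms by (intro mult_left_mono) auto
        moreover have "\<eta> / 2 * \<bar>x * 2 / \<eta> - \<lfloor>x * 2 / \<eta>\<rfloor>\<bar> = \<bar>\<eta> / 2 * (x * 2 / \<eta> - \<lfloor>x * 2 / \<eta>\<rfloor>)\<bar>"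
          using assms by (simp add: abs_mult)
        moreover have "\<eta> / 2 * (x * 2 / \<eta> - \<lfloor>x * 2 / \<eta>\<rfloor>) = x - \<eta> / 2 * \<lfloor>x * 2 / \<eta>\<rfloor>"
          using assms by (simp add: field_simps)
        ultimately show ?thesis by simp
      qed
      ultimately show ?thesis by blast
    qed
    define y where "y = pt (\<lfloor>Re z * 2 / \<eta>\<rfloor>, \<lfloor>Im z * 2 / \<eta>\<rfloor>)"
    have r: "\<bar>Re z\<bar> \<le> R" "\<bar>Im z\<bar> \<le> R" using z abs_Re_le_cmod[of z] abs_Im_le_cmod[of z] by linarith+
    have "y \<in> G" unfolding y_def G_def using coord[OF r(1)] coord[OF r(2)] by (intro imageI) simp
    moreover have "cmod (z - y) \<le> \<bar>Re (z - y)\<bar> + \<bar>Im (z - y)\<bar>" by (rule cmod_le)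
    then have "cmod (z - y) \<le> \<eta>"
      using coord[OF r(1)] coord[OF r(2)] by (simp add: y_def pt_def)
    ultimately show ?thesis by blast
  qed
  moreover have "finite G" by (simp add: G_def)
  ultimately show ?thesis by blast
qed

lemma pure_state_entry:
  assumes "finite I" "pure_state I \<psi>" "i \<in> I"
  shows "cmod (\<psi> i) \<le> 1"
proof -
  have "(cmod (\<psi> i))\<^sup>2 \<le> (\<Sum>i\<in>I. (cmod (\<psi> i))\<^sup>2)" using assms by (intro member_le_sum) auto
  then show ?thesis using assms(2) by (simp add: pure_state_def power_le_one_iff)
qed

lemma density_op_entry:
  assumes "finite I" "density_op I \<rho>" "i \<in> I" "j \<in> I"
  shows "cmod (\<rho> i j) \<le> 1"
proof -
  obtain v where v: "\<forall>i\<in>I. \<forall>j\<in>I. \<rho> i j = (\<Sum>k\<in>I. v k i * cnj (v k j))" "(\<Sum>k\<in>I. sqn I (v k)) = 1"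
    using density_decomposition[OF assms(1,2)] by blast
  have "cmod (\<rho> i j) \<le> (\<Sum>k\<in>I. cmod (v k i) * cmod (v k j))"
    using v(1) assms by (auto simp: norm_mult intro!: order_trans[OF norm_sum])
  also have "\<dots> \<le> (\<Sum>k\<in>I. sqn I (v k))"
  proof (intro sum_mono)
    fix k
    have "(cmod (v k x))\<^sup>2 \<le> sqn I (v k)" if "x \<in> I" for x
      unfolding sqn_def using assms(1) that by (intro member_le_sum) auto
    then have "(cmod (v k i))\<^sup>2 \<le> sqn I (v k)" "(cmod (v k j))\<^sup>2 \<le> sqn I (v k)" using assms by auto
    moreover have "2 * (cmod (v k i) * cmod (v k j)) \<le> (cmod (v k i))\<^sup>2 + (cmod (v k j))\<^sup>2"
      using sum_squares_bound[of "cmod (v k i)" "cmod (v k j)"] by simp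
    ultimately show "cmod (v k i) * cmod (v k j) \<le> sqn I (v k)" by linarith
  qed
  finally show ?thesis by (simp add: v(2))
qed

text \<open>A crude count: each term of the double sum changes by at most \<open>2 * t\<close>, as
  all entries have modulus at most 1. The net can be made fine enough to pay for this.\<close>

lemma fidelity_close:
  assumes "finite I" "density_op I \<rho>" "pure_state I \<psi>" "pure_state I h"
    and close: "\<And>i. i \<in> I \<Longrightarrow> cmod (\<psi> i - h i) \<le> t"
  shows "fidelity I \<rho> \<psi> \<le> fidelity I \<rho> h + 2 * t * (real (card I))\<^sup>2"
proof -
  have "fidelity I \<rho> \<psi> - fidelity I \<rho> h = Re (quad_form I \<rho> \<psi> - quad_form I \<rho> h)"
    by (simp add: fidelity_def)
  also have "\<dots> \<le> cmod (quad_form I \<rho> \<psi> - quad_form I \<rho> h)" by (rule complex_Re_le_cmod)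
  also have "quad_form I \<rho> \<psi> - quad_form I \<rho> h
    = (\<Sum>i\<in>I. \<Sum>j\<in>I. cnj (\<psi> i) * \<rho> i j * (\<psi> j - h j) + cnj (\<psi> i - h i) * \<rho> i j * h j)"
    unfolding quad_form_def sum_subtractf[symmetric] by (intro sum.cong) (auto simp: algebra_simps)
  also have "cmod \<dots> \<le> (\<Sum>i\<in>I. \<Sum>j\<in>I. t + t)"
  proof (intro order_trans[OF norm_sum] sum_mono order_trans[OF norm_triangle_ineq] add_mono)
    fix i j assume ij: "i \<in> I" "j \<in> I"
    have b: "cmod (\<psi> i) \<le> 1" "cmod (h j) \<le> 1" "cmod (\<rho> i j) \<le> 1"
      using pure_state_entry[OF assms(1,3)] pure_state_entry[OF assms(1,4)] density_op_entry[OF assms(1,2)] ij by auto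
    have t: "t \<ge> 0" using close[OF ij(1)] norm_ge_zero order_trans by blast
    have "cmod (\<psi> i) * cmod (\<rho> i j) * cmod (\<psi> j - h j) \<le> 1 * t"
      using b close[OF ij(2)] by (intro mult_mono mult_le_one) auto
    then show "cmod (cnj (\<psi> i) * \<rho> i j * (\<psi> j - h j)) \<le> t" by (simp add: norm_mult)
    have "cmod (\<psi> i - h i) * (cmod (\<rho> i j) * cmod (h j)) \<le> t * 1"
      using b close[OF ij(1)] t by (intro mult_mono mult_le_one) auto
    then show "cmod (cnj (\<psi> i - h i) * \<rho> i j * h j) \<le> t"
      by (simp only: norm_mult complex_mod_cnj mult.assoc mult_1_right)
  qed
  finally show ?thesis by (simp add: power2_eq_square algebra_simps)
qed

lemma finite_qudit_basis: "finite V \<Longrightarrow> finite (qudit_basis V d)"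
  by (simp add: qudit_basis_def finite_PiE)

lemma card_qudit_basis: "finite V \<Longrightarrow> card (qudit_basis V d) = d ^ card V"
  by (simp add: qudit_basis_def card_PiE)

text \<open>The basis state with all indices 0, a network with bond dimension 1, is a
  witness.\<close>

lemma ttn_states_nonempty:
  assumes "finite V" "d \<ge> 1" "\<chi> \<ge> 1"
  shows "ttn_states V E d \<chi> \<noteq> {}"
proof -
  define \<psi> :: "(nat \<Rightarrow> nat) \<Rightarrow> complex" where "\<psi> i = (\<Prod>v\<in>V. if i v = 0 then 1 else 0)" for i
  define i0 where "i0 = (\<lambda>v\<in>V. 0 :: nat)"
  have i0: "i0 \<in> qudit_basis V d" using assms by (auto simp: i0_def qudit_basis_def)
  have \<psi>: "\<psi> i = (if i = i0 then 1 else 0)" if i: "i \<in> qudit_basis V d" for i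
  proof (cases "i = i0")
    case False
    then obtain v where "v \<in> V" "i v \<noteq> 0"
      using i PiE_ext[of i V "\<lambda>_. {..<d}" i0] i0 by (auto simp: qudit_basis_def i0_def)
    then show ?thesis using False assms(1) by (auto simp: \<psi>_def)
  qed (simp add: \<psi>_def i0_def)
  have "(\<Sum>i\<in>qudit_basis V d. (cmod (\<psi> i))\<^sup>2) = (\<Sum>i\<in>qudit_basis V d. if i = i0 then 1 else 0)"
    by (intro sum.cong) (auto simp: \<psi>)
  also have "\<dots> = 1" using i0 finite_qudit_basis[OF assms(1)] by simp
  finally have "pure_state (qudit_basis V d) \<psi>" by (simp add: pure_state_def)
  moreover have "(\<Pi>\<^sub>E e\<in>E. {..<1::nat}) = {\<lambda>e\<in>E. 0}"
    by (auto simp: PiE_def extensional_def fun_eq_iff Pi_def)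
  then have "\<psi> i = (\<Sum>j \<in> (\<Pi>\<^sub>E e\<in>E. {..<1::nat}). \<Prod>v\<in>V. (\<lambda>v y j. if y = 0 then 1 else 0) v (i v) (restrict j (incident E v)))" for i
    by (simp add: \<psi>_def)
  ultimately have "\<psi> \<in> ttn_states V E d \<chi>"
    unfolding ttn_states_def using assms(3)
    by (intro CollectI conjI exI[of _ "\<lambda>_. 1"] exI[of _ "\<lambda>v y j. if y = 0 then 1 else 0"]) auto
  then show ?thesis by blast
qed

lemma ttn_states_subset_bounded_nets:
  assumes "finite V"
  shows "ttn_states V E d \<chi> \<subseteq> bounded_nets V E (\<lambda>_. {..<d}) \<chi>"
proof
  fix \<psi> assume "\<psi> \<in> ttn_states V E d \<chi>"
  then obtain w \<phi> where pure: "pure_state (qudit_basis V d) \<psi>" and w: "\<forall>e\<in>E. w e \<in> {1..\<chi>}"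
    and \<phi>: "\<forall>i\<in>qudit_basis V d. \<psi> i = net_value V E w \<phi> i"
    unfolding ttn_states_def net_value_def by blast
  have "\<forall>e\<in>E. w e \<le> \<chi>" using w by simp
  moreover have "\<forall>i\<in>PiE V (\<lambda>_. {..<d}). \<psi> i = net_value V E w \<phi> i \<and> cmod (\<psi> i) \<le> 1"
    using \<phi> pure_state_entry[OF finite_qudit_basis[OF assms] pure] unfolding qudit_basis_def by blast
  ultimately show "\<psi> \<in> bounded_nets V E (\<lambda>_. {..<d}) \<chi>"
    unfolding bounded_nets_def by blast
qed

text \<open>Approximants may be neither normalised nor tree networks, whereas a learner has to
  output pure states. Each approximant with a member of \<open>T\<close> nearby is exchanged for
  such a member, which doubles the radius.\<close>

lemma internal_cover:
  assumes "finite F" and F: "\<And>\<psi>. \<psi> \<in> T \<Longrightarrow> \<exists>f\<in>F. \<forall>i\<in>I. cmod (\<psi> i - f i) \<le> t"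
  shows "\<exists>H\<subseteq>T. finite H \<and> card H \<le> card F \<and> (\<forall>\<psi>\<in>T. \<exists>h\<in>H. \<forall>i\<in>I. cmod (\<psi> i - h i) \<le> 2 * t)"
proof -
  define near where "near f \<psi> \<longleftrightarrow> \<psi> \<in> T \<and> (\<forall>i\<in>I. cmod (\<psi> i - f i) \<le> t)" for f \<psi>
  define H where "H = (\<lambda>f. SOME \<psi>. near f \<psi>) ` {f\<in>F. \<exists>\<psi>. near f \<psi>}"
  have near: "near f (SOME \<psi>. near f \<psi>)" if "near f \<psi>" for f \<psi> using that by (rule someI[where P = "near f"])
  have "card H \<le> card {f\<in>F. \<exists>\<psi>. near f \<psi>}" unfolding H_def using assms(1) by (intro card_image_le) simp
  also have "\<dots> \<le> card F" using assms(1) by (intro card_mono) auto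
  finally have "card H \<le> card F" .
  moreover have "H \<subseteq> T" using near by (auto simp: H_def near_def)
  moreover have "\<exists>h\<in>H. \<forall>i\<in>I. cmod (\<psi> i - h i) \<le> 2 * t" if \<psi>: "\<psi> \<in> T" for \<psi>
  proof -
    obtain f where f: "f \<in> F" "near f \<psi>" using F[OF \<psi>] \<psi> by (auto simp: near_def)
    define h where "h = (SOME \<psi>. near f \<psi>)"
    have h: "near f h" using near[OF f(2)] by (simp add: h_def)
    have "cmod (\<psi> i - h i) \<le> 2 * t" if "i \<in> I" for i
    proof -
      have "cmod (\<psi> i - h i) \<le> cmod (\<psi> i - f i) + cmod (f i - h i)"
        using norm_triangle_ineq[of "\<psi> i - f i" "f i - h i"] by simp
      then show ?thesis using f(2) h that by (fastforce simp: near_def norm_minus_commute)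
    qed
    moreover have "h \<in> H" using f by (auto simp: H_def h_def)
    ultimately show ?thesis by blast
  qed
  ultimately show ?thesis using assms(1) by (intro exI[of _ H]) (auto simp: H_def)
qed

text \<open>The exponent \<open>\<chi> * B * n\<close> counts tabulated values and contributes one
  \<chi>, one \<open>d\<close>, one \<open>n\<close> and \<open>\<chi> ^ (2 * b)\<close>, where
  \<open>b\<close> is the largest number of children; the logarithm of the grid size contributes the
  second \<chi>, \<open>d\<close>, \<open>n\<close> and 1 / \<epsilon>.\<close>

lemma ttn_hypothesis_class:
  assumes tree: "is_tree V E" and r: "leaf_root V E r" and d: "d \<ge> 2" and \<chi>: "\<chi> \<ge> 1"
    and \<epsilon>: "0 < \<epsilon>" "\<epsilon> \<le> 1"
  shows "\<exists>H\<subseteq>ttn_states V E d \<chi>. finite H \<and> H \<noteq> {} \<and>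
    ln (real (card H)) \<le> 126 * (real (card V))\<^sup>2 * (real \<chi>)\<^sup>2 * (real d)\<^sup>2 * real \<chi> ^ (2 * max_children V E r) / \<epsilon> \<and>
    (\<forall>\<rho> \<psi>. density_op (qudit_basis V d) \<rho> \<longrightarrow> \<psi> \<in> ttn_states V E d \<chi> \<longrightarrow>
      (\<exists>h\<in>H. fidelity (qudit_basis V d) \<rho> \<psi> \<le> fidelity (qudit_basis V d) \<rho> h + \<epsilon> / 2))"
proof -
  define n where "n = card V"
  define D where "D = d ^ n"
  define I where "I = qudit_basis V d"
  define K :: real where "K = 2 ^ (\<chi> + 2)"
  define B where "B = d * \<chi> ^ (2 * max_children V E r)"
  \<comment> \<open>Chosen so that \<open>\<eta> * K ^ n = \<epsilon> / (8 * D^2)\<close>: the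
    internal cover doubles this error and \<open>fidelity_close\<close> multiplies it by
    \<open>2 * D^2\<close>, which makes \<epsilon> / 2.\<close>
  define \<eta> where "\<eta> = \<epsilon> / (8 * (real D)\<^sup>2 * K ^ n)"
  have finV: "finite V" using tree_finite[OF tree] .
  have finI: "finite I" and cI: "card I = D"
    using finite_qudit_basis[OF finV] card_qudit_basis[OF finV] by (auto simp: I_def D_def n_def)
  have n: "n \<ge> 1" using finV r by (auto simp: n_def leaf_root_def Suc_le_eq card_gt_0_iff)
  have K: "K \<ge> 1" "K ^ n \<ge> 1" unfolding K_def by (intro one_le_power; simp)+
  have D: "real D \<ge> 1" using d by (simp add: D_def)
  have D2: "(real D)\<^sup>2 \<ge> 1" using D by simp
  have \<eta>: "\<eta> > 0" using \<epsilon> K D by (auto simp: \<eta>_def intro!: divide_pos_pos mult_pos_pos)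
  have \<eta>K: "\<eta> * K ^ n = \<epsilon> / (8 * (real D)\<^sup>2)" using K by (simp add: \<eta>_def)
  have "1 \<le> 8 * (real D)\<^sup>2" using D2 by linarith
  then have "\<epsilon> / (8 * (real D)\<^sup>2) \<le> \<epsilon> / 1" by (rule divide_left_mono) (use D \<epsilon> in auto)
  then have \<eta>K1: "\<eta> * K ^ n \<le> 1" using \<eta>K \<epsilon> by simp
  have "\<eta> * 1 \<le> \<eta> * K ^ n" using \<eta> K by (intro mult_left_mono) auto
  then have "\<eta> \<le> 1" using \<eta>K1 by simp
  then have "\<eta> \<le> 2 ^ \<chi>" using one_le_power[of "2::real" \<chi>] by linarith
  then obtain G where G: "finite G" "real (card G) \<le> (7 * 2 ^ \<chi> / \<eta>)\<^sup>2"
    "\<And>z. cmod z \<le> 2 ^ \<chi> \<Longrightarrow> \<exists>y\<in>G. cmod (z - y) \<le> \<eta>"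
    using grid_exists[OF \<eta>, of "2 ^ \<chi>"] by blast
  have rooted: "rooted r V E" using tree_rooted[OF tree] r by (simp add: leaf_root_def)
  have X: "finite {..<d} \<and> {..<d} \<noteq> {} \<and> card {..<d} * \<chi> ^ degree E v \<le> B" if "v \<in> V" for v
    using d \<chi> degree_le_twice_max_children[OF tree r that] by (auto simp: B_def lessThan_empty_iff intro!: power_increasing)
  obtain F where F: "finite F" "card F \<le> card G ^ (\<chi> * B * n)"
    "\<And>\<psi>. \<psi> \<in> bounded_nets V E (\<lambda>_. {..<d}) \<chi> \<Longrightarrow> \<exists>f\<in>F. \<forall>i\<in>I. cmod (\<psi> i - f i) \<le> \<eta> * K ^ n"
    using covering_bounded_nets[OF rooted \<chi> \<eta> G(1) G(3) X] \<eta>K1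
    unfolding K_def n_def I_def qudit_basis_def by blast
  obtain H where H: "H \<subseteq> ttn_states V E d \<chi>" "finite H" "card H \<le> card F"
    "\<And>\<psi>. \<psi> \<in> ttn_states V E d \<chi> \<Longrightarrow> \<exists>h\<in>H. \<forall>i\<in>I. cmod (\<psi> i - h i) \<le> 2 * (\<eta> * K ^ n)"
  proof -
    have "\<exists>H\<subseteq>ttn_states V E d \<chi>. finite H \<and> card H \<le> card F \<and>
      (\<forall>\<psi>\<in>ttn_states V E d \<chi>. \<exists>h\<in>H. \<forall>i\<in>I. cmod (\<psi> i - h i) \<le> 2 * (\<eta> * K ^ n))"
      by (intro internal_cover F(1) F(3) subsetD[OF ttn_states_subset_bounded_nets[OF finV]])
    then show ?thesis using that by (elim exE conjE) simp
  qed
  have Hne: "H \<noteq> {}" using H(4) ttn_states_nonempty[OF finV _ \<chi>, of d E] d by fastforce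
  then have cH: "card H \<ge> 1" using H(2) by (simp add: Suc_le_eq card_gt_0_iff)
  have cG: "card G \<ge> 1"
  proof -
    have "G \<noteq> {}" using G(3)[of 0] by auto
    then show ?thesis using G(1) by (simp add: Suc_le_eq card_gt_0_iff)
  qed
  have fid: "\<exists>h\<in>H. fidelity I \<rho> \<psi> \<le> fidelity I \<rho> h + \<epsilon> / 2"
    if \<rho>: "density_op I \<rho>" and \<psi>: "\<psi> \<in> ttn_states V E d \<chi>" for \<rho> \<psi>
  proof -
    obtain h where h: "h \<in> H" "\<forall>i\<in>I. cmod (\<psi> i - h i) \<le> 2 * (\<eta> * K ^ n)" using H(4)[OF \<psi>] by blast
    have "pure_state I \<psi>" "pure_state I h" using \<psi> h H(1) by (auto simp: ttn_states_def I_def)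
    then have "fidelity I \<rho> \<psi> \<le> fidelity I \<rho> h + 2 * (2 * (\<eta> * K ^ n)) * (real D)\<^sup>2"
      using fidelity_close[OF finI \<rho>, of \<psi> h "2 * (\<eta> * K ^ n)"] h(2) unfolding cI by blast
    also have "2 * (2 * (\<eta> * K ^ n)) * (real D)\<^sup>2 = \<epsilon> / 2" unfolding \<eta>K using D by simp
    finally show ?thesis using h(1) by blast
  qed
  have lnG: "ln (real (card G)) \<le> 126 * (real n * real \<chi> * real d / \<epsilon>)"
  proof -
    \<comment> \<open>Every term of the logarithm is bounded by a multiple of the single quantity
      \<open>Q\<close>; the multiples 56, 1, 2, 3, 1 add up to 63, and the square in the grid size
      doubles this to 126.\<close>
    define Q where "Q = real n * real \<chi> * real d / \<epsilon>"
    have one: "1 \<le> real n" "1 \<le> real \<chi>" "1 \<le> real d" "1 \<le> 1 / \<epsilon>" using n \<chi> d \<epsilon> by auto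
    have prods: "a * b * c * e \<le> real n * real \<chi> * real d * (1 / \<epsilon>)"
      if "0 \<le> a" "a \<le> real n" "0 \<le> b" "b \<le> real \<chi>" "0 \<le> c" "c \<le> real d" "0 \<le> e" "e \<le> 1 / \<epsilon>" for a b c e
      using that one by (intro mult_mono) auto
    have Q: "1 \<le> Q" "real \<chi> \<le> Q" "real n * real d \<le> Q" "real n * real \<chi> \<le> Q" "1 / \<epsilon> \<le> Q"
      using prods[of 1 1 1 1] prods[of 1 "real \<chi>" 1 1] prods[of "real n" 1 "real d" 1] prods[of "real n" "real \<chi>" 1 1]
        prods[of 1 1 1 "1 / \<epsilon>"] one \<epsilon> by (simp_all add: Q_def)
    have "7 * 2 ^ \<chi> / \<eta> = 56 * 2 ^ \<chi> * (real d ^ n)\<^sup>2 * (2 ^ (\<chi> + 2)) ^ n / \<epsilon>"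
      using \<epsilon> by (simp add: \<eta>_def K_def D_def)
    then have "ln (7 * 2 ^ \<chi> / \<eta>) = ln 56 + \<chi> * ln 2 + 2 * (n * ln d) + n * ((\<chi> + 2) * ln 2) + ln (1 / \<epsilon>)"
      using \<epsilon> d by (simp add: ln_mult ln_div ln_realpow del: power_Suc power_add)
    also have "\<dots> \<le> 56 * Q + Q + 2 * Q + 3 * Q + Q"
    proof (intro add_mono)
      have l2: "ln 2 \<le> (1::real)" using ln_2_less_1 by simp
      have "ln (56::real) \<le> 56" using ln_le_minus_one[of "56::real"] by simp
      then show "ln 56 \<le> 56 * Q" using Q by simp
      have "\<chi> * ln 2 \<le> \<chi> * (1::real)" using l2 by (intro mult_left_mono) auto
      then show "\<chi> * ln 2 \<le> Q" using Q by simp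
      have "ln d \<le> real d" using ln_le_minus_one[of "real d"] d by simp
      then have "n * ln d \<le> real n * real d" by (intro mult_left_mono) auto
      then show "2 * (n * ln d) \<le> 2 * Q" using Q by simp
      have "n * ((\<chi> + 2) * ln 2) \<le> real n * ((\<chi> + 2) * 1)" using l2 by (intro mult_left_mono) auto
      also have "\<dots> \<le> real n * (3 * real \<chi>)" using \<chi> by (intro mult_left_mono) auto
      finally show "n * ((\<chi> + 2) * ln 2) \<le> 3 * Q" using Q by simp
      show "ln (1 / \<epsilon>) \<le> Q" using ln_le_minus_one[of "1 / \<epsilon>"] \<epsilon> Q by simp
    qed
    finally have "ln (7 * 2 ^ \<chi> / \<eta>) \<le> 63 * Q" by simp
    moreover have "ln (real (card G)) \<le> 2 * ln (7 * 2 ^ \<chi> / \<eta>)"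
    proof -
      have "ln (real (card G)) \<le> ln ((7 * 2 ^ \<chi> / \<eta>)\<^sup>2)" using G(2) cG by (subst ln_le_cancel_iff) (auto intro: less_le_trans)
      then show ?thesis using \<eta> by (simp add: ln_realpow)
    qed
    ultimately show ?thesis by (simp add: Q_def)
  qed
  have "ln (real (card H)) \<le> ln (real (card G) ^ (\<chi> * B * n))"
  proof -
    have "card H \<le> card G ^ (\<chi> * B * n)" using H(3) F(2) by simp
    then have "real (card H) \<le> real (card G) ^ (\<chi> * B * n)" by (simp flip: of_nat_power)
    then show ?thesis using cH cG by (subst ln_le_cancel_iff) auto
  qed
  also have "\<dots> = real (\<chi> * B * n) * ln (real (card G))" using cG by (simp add: ln_realpow)
  also have "\<dots> \<le> real (\<chi> * B * n) * (126 * (real n * real \<chi> * real d / \<epsilon>))"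
    using lnG by (intro mult_left_mono) auto
  also have "\<dots> = 126 * (real n)\<^sup>2 * (real \<chi>)\<^sup>2 * (real d)\<^sup>2 * real \<chi> ^ (2 * max_children V E r) / \<epsilon>"
    by (simp add: B_def power2_eq_square)
  finally show ?thesis using H(1,2) Hne fid unfolding n_def I_def by blast
qed

text \<open>\<open>p_T\<close> is the least positive exponent for which \<open>d ^ p\<close> reaches
  \<open>2048 * n^2 * \<chi> / m^2\<close>, and this exceeds \<chi>. It converts powers of the bond
  dimension into powers of \<open>d\<close>.\<close>

lemma bond_dimension_le:
  assumes "n \<ge> 1" "d \<ge> 2" "\<chi> \<ge> 1" "0 < \<epsilon>" "\<epsilon> \<le> 1" "0 < \<theta>" "\<theta> \<le> 1"
  shows "real \<chi> \<le> real d ^ p_T n d \<chi> \<epsilon> \<theta>"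
proof -
  define m where "m = min \<epsilon> \<theta>"
  define x where "x = 2048 * (real n)\<^sup>2 * real \<chi> / m\<^sup>2"
  have m: "0 < m" "m \<le> 1" using assms by (auto simp: m_def)
  have "real \<chi> * 1 \<le> real \<chi> * (2048 * (real n)\<^sup>2 / m\<^sup>2)"
  proof (intro mult_left_mono)
    have "m\<^sup>2 \<le> 1" using m by (simp add: power_le_one)
    moreover have "1 \<le> (real n)\<^sup>2" using assms by simp
    ultimately have "m\<^sup>2 \<le> 2048 * (real n)\<^sup>2" by linarith
    then show "1 \<le> 2048 * (real n)\<^sup>2 / m\<^sup>2" using m by simp
  qed simp
  then have \<chi>x: "real \<chi> \<le> x" by (simp add: x_def mult_ac)
  then have x: "x > 0" using assms by linarith
  have "log (real d) x \<le> real (p_T n d \<chi> \<epsilon> \<theta>)"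
    unfolding p_T_def x_def[symmetric] m_def[symmetric] by linarith
  then have "real d powr log (real d) x \<le> real d powr real (p_T n d \<chi> \<epsilon> \<theta>)"
    using assms by (intro powr_mono) auto
  then have "x \<le> real d ^ p_T n d \<chi> \<epsilon> \<theta>" using assms x by (simp add: powr_realpow)
  then show ?thesis using \<chi>x by linarith
qed

text \<open>Selection costs \<open>1 / \<epsilon> ^ 2\<close> and the logarithm of the net another
  \<open>1 / \<epsilon>\<close>; \<open>\<theta> * m ^ 4 \<le> \<epsilon> ^ 3\<close> holds because
  \<open>m \<le> \<epsilon>\<close> and both \<open>m\<close> and \<theta> are at most 1.\<close>

lemma sample_bound:
  assumes n: "n \<ge> 1" and d: "d \<ge> 2" and \<chi>: "\<chi> \<ge> 1" and \<epsilon>: "0 < \<epsilon>" "\<epsilon> \<le> 1" and \<theta>: "0 < \<theta>" "\<theta> \<le> 1"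
    and \<delta>: "0 < \<delta>" "\<delta> < 1" and p: "p = p_T n d \<chi> \<epsilon> \<theta>" and M: "M \<ge> 1"
    and lnM: "ln M \<le> 126 * (real n)\<^sup>2 * (real \<chi>)\<^sup>2 * (real d)\<^sup>2 * real \<chi> ^ (2 * b) / \<epsilon>"
    and N: "N = nat \<lceil>864 * ln (2 * M / \<delta>) / \<epsilon>\<^sup>2\<rceil>"
  shows "real N \<le> 110000 * (real n ^ 5 * (real \<chi>)\<^sup>2 / (\<theta> * (min \<epsilon> \<theta>) ^ 4)
                       * (real d ^ (2 * (1 + b * p)) + ln (real n / \<delta>)))"
proof -
  define m where "m = min \<epsilon> \<theta>"
  define S where "S = real n ^ 5 * (real \<chi>)\<^sup>2 / (\<theta> * m ^ 4)"
  define A where "A = real d ^ (2 * (1 + b * p))"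
  have m: "0 < m" "m \<le> 1" "m \<le> \<epsilon>" using assms by (auto simp: m_def)
  have n1: "1 \<le> real n" and \<chi>1: "1 \<le> real \<chi>" using n \<chi> by auto
  have den: "0 < \<theta> * m ^ 4" "\<theta> * m ^ 4 \<le> \<epsilon> ^ 3" "\<theta> * m ^ 4 \<le> \<epsilon>\<^sup>2" "\<theta> * m ^ 4 \<le> 1"
  proof -
    show "0 < \<theta> * m ^ 4" using m \<theta> by simp
    have "\<theta> * m ^ 4 \<le> 1 * m ^ 4" using \<theta> m by (intro mult_right_mono) auto
    then have 1: "\<theta> * m ^ 4 \<le> m ^ 4" by simp
    have "m ^ 4 \<le> m ^ k" if "k \<le> 4" for k using m that by (intro power_decreasing) auto
    then have 2: "\<theta> * m ^ 4 \<le> m ^ k" if "k \<le> 4" for k using 1 that order_trans by blast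
    have "m ^ k \<le> \<epsilon> ^ k" for k using m by (intro power_mono) auto
    then show "\<theta> * m ^ 4 \<le> \<epsilon> ^ 3" "\<theta> * m ^ 4 \<le> \<epsilon>\<^sup>2" "\<theta> * m ^ 4 \<le> 1"
      using order_trans[OF 2[of 3]] order_trans[OF 2[of 2]] 2[of 0] by auto
  qed
  have num: "(real n)\<^sup>2 * (real \<chi>)\<^sup>2 \<le> real n ^ 5 * (real \<chi>)\<^sup>2" "1 \<le> real n ^ 5 * (real \<chi>)\<^sup>2"
  proof -
    show "(real n)\<^sup>2 * (real \<chi>)\<^sup>2 \<le> real n ^ 5 * (real \<chi>)\<^sup>2"
      using n1 by (intro mult_right_mono power_increasing) auto
    have "1 * 1 \<le> real n ^ 5 * (real \<chi>)\<^sup>2" using n1 \<chi>1 by (intro mult_mono one_le_power) auto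
    then show "1 \<le> real n ^ 5 * (real \<chi>)\<^sup>2" by simp
  qed
  have S3: "(real n)\<^sup>2 * (real \<chi>)\<^sup>2 / \<epsilon> ^ 3 \<le> S"
    unfolding S_def using num den by (intro frac_le) auto
  have S2: "1 / \<epsilon>\<^sup>2 \<le> S" and S1: "1 / 1 \<le> S"
    unfolding S_def using num den by (intro frac_le; auto)+
  have A1: "1 \<le> A" using d unfolding A_def by (intro one_le_power) auto
  have A2: "(real d)\<^sup>2 * real \<chi> ^ (2 * b) \<le> A"
  proof -
    have "real \<chi> ^ (2 * b) \<le> (real d ^ p) ^ (2 * b)"
      unfolding p using bond_dimension_le[OF n d \<chi> \<epsilon> \<theta>] by (intro power_mono) auto
    then have "(real d)\<^sup>2 * real \<chi> ^ (2 * b) \<le> (real d)\<^sup>2 * (real d ^ p) ^ (2 * b)" by (intro mult_left_mono) auto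
    also have "\<dots> = A" by (simp add: A_def flip: power_mult power_add) (simp add: mult_ac)
    finally show ?thesis .
  qed
  define L where "L = ln (1 / \<delta>)"
  have L: "0 \<le> L" "L \<le> ln (real n / \<delta>)"
  proof -
    show "0 \<le> L" using \<delta> by (simp add: L_def)
    have "1 / \<delta> \<le> real n / \<delta>" using n1 \<delta> by (intro divide_right_mono) auto
    then show "L \<le> ln (real n / \<delta>)" unfolding L_def using \<delta> n1 by (subst ln_le_cancel_iff) auto
  qed
  have split: "ln (2 * M / \<delta>) = ln 2 + ln M + L"
    using M \<delta> by (simp add: L_def ln_mult ln_div)
  have "0 \<le> ln (2 * M / \<delta>)" unfolding split using M L by simp
  then have "real N \<le> 864 * ln (2 * M / \<delta>) / \<epsilon>\<^sup>2 + 1" unfolding N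
    using \<epsilon> by simp
  also have "\<dots> = 864 * (ln 2 * (1 / \<epsilon>\<^sup>2)) + 864 * (ln M * (1 / \<epsilon>\<^sup>2)) + 864 * (L * (1 / \<epsilon>\<^sup>2)) + 1"
    unfolding split by (simp add: algebra_simps add_divide_distrib)
  also have "\<dots> \<le> 864 * (1 * S) + 864 * (126 * (S * A)) + 864 * (S * ln (real n / \<delta>)) + 1 * S"
  proof (intro add_mono mult_left_mono)
    show "ln 2 * (1 / \<epsilon>\<^sup>2) \<le> 1 * S" using S2 ln_2_less_1 by (intro mult_mono) auto
    have "ln M * (1 / \<epsilon>\<^sup>2) \<le> (126 * (real n)\<^sup>2 * (real \<chi>)\<^sup>2 * (real d)\<^sup>2 * real \<chi> ^ (2 * b) / \<epsilon>) * (1 / \<epsilon>\<^sup>2)"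
      using lnM by (intro mult_right_mono) auto
    also have "\<dots> = 126 * (((real n)\<^sup>2 * (real \<chi>)\<^sup>2 / \<epsilon> ^ 3) * ((real d)\<^sup>2 * real \<chi> ^ (2 * b)))"
      by (simp add: power2_eq_square power3_eq_cube)
    also have "\<dots> \<le> 126 * (S * A)" using S3 A2 S1 by (intro mult_left_mono mult_mono) auto
    finally show "ln M * (1 / \<epsilon>\<^sup>2) \<le> 126 * (S * A)" .
    have "L * (1 / \<epsilon>\<^sup>2) \<le> ln (real n / \<delta>) * S" using L S2 by (intro mult_mono) auto
    then show "L * (1 / \<epsilon>\<^sup>2) \<le> S * ln (real n / \<delta>)" by (simp only: mult.commute)
  qed (use S1 in auto)
  \<comment> \<open>\<open>864 * 126 + 864 + 1 = 109729\<close>; the last 1 pays for rounding up in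
    \<open>N\<close>, the middle term for \<open>ln 2\<close>.\<close>
  also have "\<dots> \<le> 110000 * (S * A) + 110000 * (S * ln (real n / \<delta>))"
  proof -
    have "S * 1 \<le> S * A" using S1 A1 by (intro mult_left_mono) auto
    moreover have "0 \<le> S * ln (real n / \<delta>)" using S1 L by (intro mult_nonneg_nonneg) auto
    ultimately show ?thesis using S1 by linarith
  qed
  also have "\<dots> = 110000 * (S * (A + ln (real n / \<delta>)))" by (simp add: algebra_simps)
  finally show ?thesis unfolding S_def A_def m_def .
qed

text \<open>Half of \<epsilon> covers the passage from tree states to the net, the other half the
  selection from the net.\<close>

lemma ttn_learner:
  assumes tree: "is_tree V E" and r: "leaf_root V E r" and d: "d \<ge> 2" and \<chi>: "\<chi> \<ge> 1"
    and \<epsilon>: "0 < \<epsilon>" "\<epsilon> \<le> 1" and \<delta>: "0 < \<delta>" "\<delta> < 1" and \<theta>: "0 < \<theta>" "\<theta> \<le> 1"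
    and n: "n = card V" and b: "b = max_children V E r" and p: "p = p_T n d \<chi> \<epsilon> \<theta>"
  shows "\<exists>N \<Omega> M out.
    real N \<le> 110000 * (real n ^ 5 * (real \<chi>)\<^sup>2 / (\<theta> * (min \<epsilon> \<theta>) ^ 4)
                       * (real d ^ (2 * (1 + b * p)) + ln (real n / \<delta>))) \<and>
    learner (qudit_basis V d) N \<Omega> M out \<and>
    (\<forall>\<rho>. density_op (qudit_basis V d) \<rho> \<longrightarrow>
      success_prob (qudit_basis V d) N \<Omega> M out \<rho>
        (\<lambda>\<psi>. fidelity (qudit_basis V d) \<rho> \<psi> \<ge> OPT V E d \<chi> \<rho> - \<epsilon>) \<ge> 1 - \<delta>)"
proof -
  define I where "I = qudit_basis V d"
  have finV: "finite V" using tree_finite[OF tree] .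
  have finI: "finite I" using finite_qudit_basis[OF finV] by (simp add: I_def)
  have n1: "n \<ge> 1" using finV r by (auto simp: n leaf_root_def Suc_le_eq card_gt_0_iff)
  obtain H where H: "H \<subseteq> ttn_states V E d \<chi>" "finite H" "H \<noteq> {}"
    "ln (real (card H)) \<le> 126 * (real n)\<^sup>2 * (real \<chi>)\<^sup>2 * (real d)\<^sup>2 * real \<chi> ^ (2 * b) / \<epsilon>"
    "\<And>\<rho> \<psi>. density_op I \<rho> \<Longrightarrow> \<psi> \<in> ttn_states V E d \<chi> \<Longrightarrow>
      \<exists>h\<in>H. fidelity I \<rho> \<psi> \<le> fidelity I \<rho> h + \<epsilon> / 2"
    using ttn_hypothesis_class[OF tree r d \<chi> \<epsilon>] unfolding n b I_def by blast
  have pure: "pure_state I h" if "h \<in> H" for h using H(1) that by (auto simp: ttn_states_def I_def)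
  define N where "N = nat \<lceil>864 * ln (2 * real (card H) / \<delta>) / \<epsilon>\<^sup>2\<rceil>"
  have N: "real N \<ge> 864 * ln (2 * real (card H) / \<delta>) / \<epsilon>\<^sup>2" unfolding N_def by linarith
  have cH: "real (card H) \<ge> 1" using H by (simp add: Suc_le_eq card_gt_0_iff)
  obtain \<Omega> M out where L: "learner I N \<Omega> M out"
    "\<forall>\<rho> good. density_op I \<rho> \<longrightarrow>
      (\<forall>\<psi>\<in>H. (\<forall>h\<in>H. fidelity I \<rho> \<psi> \<ge> fidelity I \<rho> h - \<epsilon> / 2) \<longrightarrow> good \<psi>) \<longrightarrow>
      success_prob I N \<Omega> M out \<rho> good \<ge> 1 - \<delta>"
  proof -
    have "\<exists>\<Omega> M out. learner I N \<Omega> M out \<and> (\<forall>\<rho> good. density_op I \<rho> \<longrightarrow>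
      (\<forall>\<psi>\<in>H. (\<forall>h\<in>H. fidelity I \<rho> \<psi> \<ge> fidelity I \<rho> h - \<epsilon> / 2) \<longrightarrow> good \<psi>) \<longrightarrow>
      success_prob I N \<Omega> M out \<rho> good \<ge> 1 - \<delta>)"
      by (rule agnostic_selection[OF finI H(2,3) _ \<epsilon>(1) \<delta>(1) N]) (rule pure)
    then show ?thesis by (elim exE conjE) (rule that)
  qed
  have success: "success_prob I N \<Omega> M out \<rho> (\<lambda>\<psi>. fidelity I \<rho> \<psi> \<ge> OPT V E d \<chi> \<rho> - \<epsilon>) \<ge> 1 - \<delta>"
    if \<rho>: "density_op I \<rho>" for \<rho>
  proof (rule L(2)[THEN spec, THEN spec, THEN mp, THEN mp, OF \<rho>], intro ballI impI)
    fix \<psi> assume \<psi>: "\<psi> \<in> H" "\<forall>h\<in>H. fidelity I \<rho> \<psi> \<ge> fidelity I \<rho> h - \<epsilon> / 2"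
    have "OPT V E d \<chi> \<rho> \<le> fidelity I \<rho> \<psi> + \<epsilon>"
      unfolding OPT_def I_def[symmetric]
    \<comment> \<open>Comparing with each tree state separately settles the supremum without a
      maximiser.\<close>
    proof (rule cSUP_least)
      show "ttn_states V E d \<chi> \<noteq> {}" using H by blast
      fix \<phi> assume "\<phi> \<in> ttn_states V E d \<chi>"
      then obtain h where "h \<in> H" "fidelity I \<rho> \<phi> \<le> fidelity I \<rho> h + \<epsilon> / 2" using H(5)[OF \<rho>] by blast
      then show "fidelity I \<rho> \<phi> \<le> fidelity I \<rho> \<psi> + \<epsilon>" using \<psi>(2) by fastforce
    qed
    then show "fidelity I \<rho> \<psi> \<ge> OPT V E d \<chi> \<rho> - \<epsilon>" by linarith
  qed
  have samples: "real N \<le> 110000 * (real n ^ 5 * (real \<chi>)\<^sup>2 / (\<theta> * (min \<epsilon> \<theta>) ^ 4)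
                       * (real d ^ (2 * (1 + b * p)) + ln (real n / \<delta>)))"
    by (rule sample_bound[OF n1 d \<chi> \<epsilon> \<theta> \<delta> p cH H(4) N_def])
  show ?thesis
    unfolding I_def[symmetric]
    by (intro exI[of _ N] exI[of _ \<Omega>] exI[of _ M] exI[of _ out] conjI allI impI L(1) samples success)
qed

theorem corollary4p48:
  shows "\<exists>C::real. C > 0 \<and>
    (\<forall>(V :: nat set) (E :: nat set set) (r :: nat) (n :: nat) (b :: nat) (p :: nat)
       (d :: nat) (\<chi> :: nat) (\<epsilon> :: real) (\<delta> :: real) (\<theta> :: real).
       is_tree V E \<and> n = card V \<and> leaf_root V E r \<and> b = max_children V E r \<and>
       d \<ge> 2 \<and> \<chi> \<ge> 1 \<and> 0 < \<epsilon> \<and> \<epsilon> \<le> 1 \<and> 0 < \<delta> \<and> \<delta> < 1 \<and> 0 < \<theta> \<and> \<theta> \<le> 1 \<and>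
       p = p_T n d \<chi> \<epsilon> \<theta>
       \<longrightarrow>
       (\<exists>N \<Omega> M out.
          real N \<le> C * (real n ^ 5 * (real \<chi>)\<^sup>2 / (\<theta> * (min \<epsilon> \<theta>) ^ 4)
                       * (real d ^ (2 * (1 + b * p)) + ln (real n / \<delta>))) \<and>
          learner (qudit_basis V d) N \<Omega> M out \<and>
          (\<forall>\<rho>. density_op (qudit_basis V d) \<rho> \<and> OPT V E d \<chi> \<rho> \<ge> \<theta>
             \<longrightarrow> success_prob (qudit_basis V d) N \<Omega> M out \<rho>
                   (\<lambda>\<psi>. fidelity (qudit_basis V d) \<rho> \<psi> \<ge> OPT V E d \<chi> \<rho> - \<epsilon>)
                 \<ge> 1 - \<delta>)) \<and>
       (n \<ge> 3 \<longrightarrow> b \<le> max_degree V E - 1))"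
proof (intro exI[of _ "110000::real"] conjI allI impI, goal_cases)
  case 1
  show ?case by simp
next
  case (2 V E r n b p d \<chi> \<epsilon> \<delta> \<theta>)
  then show ?case using ttn_learner[of V E r d \<chi> \<epsilon> \<delta> \<theta> n b p] by blast
next
  case (3 V E r n b p d \<chi> \<epsilon> \<delta> \<theta>)
  then show ?case using max_children_le[of V E r] by simp
qed

end
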